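(* Let $K\in\mathbb N_0$, let $\chi$ be a one-dimensional representation of $\mathfrak k$, let $\lambda\in\overline P^+_K(\chi,\chi)$ and $\varphi\in\overline{\delta V(\lambda)}^\chi\otimes\overline{V(\lambda)}^\chi$. Then there exists $T\ge0$ such that $\Psi(\varphi)$ converges on the region $\{(z,u,\tau)\in D\mid\mathrm{Im}(\tau)>T\}$.
   Context: Let $e,f,h$ be the standard basis of $\mathfrak{sl}_2(\mathbb C)$, $(\cdot,\cdot)$ the invariant form with $(e,f)=1$, and $\mathfrak g=\widehat{\mathfrak{sl}}_2=\mathbb{C}[t,t^{-1}]\otimes\mathfrak{sl}_2\oplus\mathbb{C}c\oplus\mathbb{C}d$ with $[t^m\otimes x,t^n\otimes y]=t^{m+n}\otimes[x,y]+m\delta_{m,-n}(x,y)c$, $[d,t^n\otimes x]=n\,t^n\otimes x$, $c$ central. Put $e_0=t\otimes f$, $f_0=t^{-1}\otimes e$, $h_0=-1\otimes h+c$, $e_1=1\otimes e$, $f_1=1\otimes f$, $h_1=1\otimes h$. The Chevalley involution $\hat\theta$ is $d\mapsto-d$, $e_j\mapsto-f_j$, $f_j\mapsto-e_j$, $h_j\mapsto-h_j$; $\mathfrak k=\mathfrak g^{\hat\theta}$ is generated by $B_j=i(e_j-f_j)$, $j=0,1$. $\mathfrak h=\mathrm{span}\{h_0,h_1,d\}$; simple roots: $\alpha_k(h_k)=2$, $\alpha_k(h_l)=-2$ ($k\ne l$), $\alpha_0(d)=1$, $\alpha_1(d)=0$; $\delta=\alpha_0+\alpha_1$; $\varpi_k(h_l)=\delta_{k,l}$,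 $\varpi_k(d)=0$; $\rho=\varpi_0+\varpi_1$. $P=\{\lambda\in\mathfrak h^*\mid\lambda(h_0),\lambda(h_1),\lambda(d)\in\mathbb Z\}$; $P_K=\{\lambda\in P\mid\lambda(c)=K\}$; $\overline P^+_K=\{\lambda\in P_K\mid\lambda(h_0),\lambda(h_1)\in\mathbb N_0,\ \lambda(d)=0\}$; $\overline P^+_K(\chi,\chi)=\{\lambda\in\overline P_K^+\mid\lambda(h_j)-|\chi(B_j)|\in2\mathbb N_0,\ j=0,1\}$. The form on $\mathfrak h$ with $(h_1,h_1)=2$, $(c,d)=1$, other pairings of $h_1,c,d$ zero, identifies $\mathfrak h\cong\mathfrak h^*$ and induces $(\cdot,\cdot)$ on $\mathfrak h^*$. $V(\lambda)$ is the integrable irreducible highest weight module of highest weight $\lambda$; $\delta V(\lambda)=\bigoplus_\mu V(\lambda)_\mu^*$ its graded dual, a right $\mathfrak g$-module by $(fx)(v)=f(xv)$; $\overline{V(\lambda)}=\prod_\mu V(\lambda)_\mu$, $\overline{\delta V(\lambda)}=\prod_\mu V(\lambda)_\mu^*$; $\overline{V(\lambda)}^\chi=\{v\mid xv=\chi(x)v\ \forall x\in\mathfrak k\}$, $\overline{\delta V(\lambda)}^\chi=\{f\mid fx=\chi(x)f\ \forall x\in\mathfrak k\}$. $\overline{\mathbb C}[P]$ is the direct sum over $K\in\mathbb Z$ of the spaces of formal sums $\sum_{\lambda\in P_K}a_\lambda e^\lambda$ such that for each $N$ only finitely many $\lambda$ have $a_\lambda\ne0$, $(\lambda,\rho)\ge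 N$. For $\varphi=\sum f_\mu\otimes v_\nu$ (possibly infinite, $f_\mu\in V(\lambda)_\mu^*$, $v_\nu\in V(\lambda)_\nu$), $\Psi(\varphi)=\sum f_\mu(v_\nu)e^\nu\in\overline{\mathbb C}[P]$. Let $\mathcal H$ be the upper half plane, $Y=\mathbb C\times\mathbb C\times\mathcal H$ with coordinates $(z,u,\tau)$. For $\lambda=c_1\alpha_1+K\varpi_0+n\delta\in P$ regard $e^\lambda$ as the function $e^\lambda(z,u,\tau)=e^{\pi i(2c_1z+Ku-n\tau)}$ on $Y$. An element $\sum a_\lambda e^\lambda\in\overline{\mathbb C}[P]$ converges on an open subset $U\subseteq Y$ if this series of functions converges absolutely and locally uniformly on $U$. $D=\{(z,u,\tau)\in Y\mid-\mathrm{Im}(\tau)/2<\mathrm{Im}(z)<0\}$. *)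

theory Defs
  imports "HOL-Analysis.Analysis" "HOL-Library.Poly_Mapping"
begin

abbreviation "lookup \<equiv> Poly_Mapping.lookup"
abbreviation "keys \<equiv> Poly_Mapping.keys"

section \<open>The Lie algebra \<open>sl\<^sub>2\<close>\<close>

text \<open>The vector with entries \<open>x $ 1\<close>, \<open>x $ 2\<close>, \<open>x $ 3\<close> stands for
  \<open>x $ 1 * e + x $ 2 * f + x $ 3 * h\<close>; see \<open>sl2_matrix\<close>.\<close>

type_synonym sl2 = "complex ^ 3"

definition sl2_e :: sl2 where "sl2_e = vector [1, 0, 0]"
definition sl2_f :: sl2 where "sl2_f = vector [0, 1, 0]"
definition sl2_h :: sl2 where "sl2_h = vector [0, 0, 1]"

definition sl2_bracket :: "sl2 \<Rightarrow> sl2 \<Rightarrow> sl2" where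
  "sl2_bracket x y = vector
     [2 * (x $ 3 * y $ 1 - x $ 1 * y $ 3),
      2 * (x $ 2 * y $ 3 - x $ 3 * y $ 2),
      x $ 1 * y $ 2 - x $ 2 * y $ 1]"

definition sl2_form :: "sl2 \<Rightarrow> sl2 \<Rightarrow> complex" where
  "sl2_form x y = x $ 1 * y $ 2 + x $ 2 * y $ 1 + 2 * (x $ 3 * y $ 3)"

definition sl2_matrix :: "sl2 \<Rightarrow> complex ^ 2 ^ 2" where
  "sl2_matrix x = vector [vector [x $ 3, x $ 1], vector [x $ 2, - (x $ 3)]]"

lemma sl2_eqI: "x $ 1 = y $ 1 \<Longrightarrow> x $ 2 = y $ 2 \<Longrightarrow> x $ 3 = y $ 3 \<Longrightarrow> x = y" for x y :: sl2
  by (simp add: vec_eq_iff forall_3)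

lemma sl2_matrix_bracket:
  "sl2_matrix (sl2_bracket x y) =
     sl2_matrix x ** sl2_matrix y - sl2_matrix y ** sl2_matrix x"
  by (simp add: sl2_matrix_def sl2_bracket_def matrix_matrix_mult_def vec_eq_iff
      forall_2 sum_2 algebra_simps)

lemma sl2_form_trace: "sl2_form x y = trace (sl2_matrix x ** sl2_matrix y)"
  by (simp add: sl2_matrix_def sl2_form_def matrix_matrix_mult_def trace_def sum_2)


section \<open>The affine Lie algebra\<close>

text \<open>A triple \<open>(p, a, b)\<close> stands for \<open>(\<Sum>n. t\<^sup>n \<otimes> p\<^sub>n) + a c + b d\<close>.\<close>

type_synonym affine = "(int \<Rightarrow>\<^sub>0 sl2) \<times> complex \<times> complex"

definition loop :: "int \<Rightarrow> sl2 \<Rightarrow> affine" where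
  "loop n x = (Poly_Mapping.single n x, 0, 0)"

definition central :: affine where "central = (0, 1, 0)"
definition degree_d :: affine where "degree_d = (0, 0, 1)"

definition affine_scale :: "complex \<Rightarrow> affine \<Rightarrow> affine" where
  "affine_scale s = (\<lambda>(p, a, b). (Poly_Mapping.map ((*s) s) p, s * a, s * b))"

lemma lookup_map_scale: "lookup (Poly_Mapping.map ((*s) s) p) n = s *s lookup p n"
  for p :: "int \<Rightarrow>\<^sub>0 sl2"
  by (transfer, simp add: when_def)

interpretation affine: vector_space affine_scale
  by unfold_locales
    (auto simp: affine_scale_def lookup_map_scale lookup_add vec_eq_iff algebra_simps
      intro!: poly_mapping_eqI)

definition loop_bracket :: "(int \<Rightarrow>\<^sub>0 sl2) \<Rightarrow> (int \<Rightarrow>\<^sub>0 sl2) \<Rightarrow> (int \<Rightarrow>\<^sub>0 sl2)" where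
  "loop_bracket p q = (\<Sum>m\<in>keys p. \<Sum>n\<in>keys q.
     Poly_Mapping.single (m + n) (sl2_bracket (lookup p m) (lookup q n)))"

definition loop_cocycle :: "(int \<Rightarrow>\<^sub>0 sl2) \<Rightarrow> (int \<Rightarrow>\<^sub>0 sl2) \<Rightarrow> complex" where
  "loop_cocycle p q =
     (\<Sum>m\<in>keys p. of_int m * sl2_form (lookup p m) (lookup q (- m)))"

definition loop_deriv :: "(int \<Rightarrow>\<^sub>0 sl2) \<Rightarrow> (int \<Rightarrow>\<^sub>0 sl2)" where
  "loop_deriv p = (\<Sum>n\<in>keys p. Poly_Mapping.single n (of_int n *s lookup p n))"

definition affine_bracket :: "affine \<Rightarrow> affine \<Rightarrow> affine" where
  "affine_bracket = (\<lambda>(p, a, b) (q, a', b').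
     (loop_bracket p q + Poly_Mapping.map ((*s) b) (loop_deriv q)
        - Poly_Mapping.map ((*s) b') (loop_deriv p),
      loop_cocycle p q, 0))"

lemma sl2_bracket_0 [simp]: "sl2_bracket 0 y = 0" "sl2_bracket x 0 = 0"
  by (simp_all add: sl2_bracket_def vec_eq_iff forall_3)

lemma sl2_form_0 [simp]: "sl2_form 0 y = 0" "sl2_form x 0 = 0"
  by (simp_all add: sl2_form_def)

lemma map_scale_0 [simp]:
  "Poly_Mapping.map ((*s) s) (0 :: int \<Rightarrow>\<^sub>0 sl2) = 0"
  "Poly_Mapping.map ((*s) 0) (p :: int \<Rightarrow>\<^sub>0 sl2) = 0"
  by (auto simp: lookup_map_scale intro!: poly_mapping_eqI)

lemma lookup_loop_bracket:
  assumes "finite S" "keys p \<subseteq> S"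
  shows "lookup (loop_bracket p q) k =
    (\<Sum>m\<in>S. sl2_bracket (lookup p m) (lookup q (k - m)))"
proof -
  have "lookup (loop_bracket p q) k = (\<Sum>m\<in>keys p. \<Sum>n\<in>keys q.
      if n = k - m then sl2_bracket (lookup p m) (lookup q n) else 0)"
    unfolding loop_bracket_def lookup_sum
    by (intro sum.cong refl) (auto simp: lookup_single when_def algebra_simps)
  also have "\<dots> = (\<Sum>m\<in>keys p. sl2_bracket (lookup p m) (lookup q (k - m)))"
    by (intro sum.cong refl) (simp add: sum.delta' sum.delta in_keys_iff)
  also have "\<dots> = (\<Sum>m\<in>S. sl2_bracket (lookup p m) (lookup q (k - m)))"
    using assms by (intro sum.mono_neutral_left) (auto simp: in_keys_iff)
  finally show ?thesis .
qed

lemma loop_cocycle_superset: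
  assumes "finite S" "keys p \<subseteq> S"
  shows "loop_cocycle p q = (\<Sum>m\<in>S. of_int m * sl2_form (lookup p m) (lookup q (- m)))"
  unfolding loop_cocycle_def
  using assms by (intro sum.mono_neutral_left) (auto simp: in_keys_iff)

lemma lookup_loop_deriv: "lookup (loop_deriv p) k = of_int k *s lookup p k"
proof -
  have "lookup (loop_deriv p) k = (\<Sum>n\<in>keys p. if n = k then of_int n *s lookup p n else 0)"
    unfolding loop_deriv_def lookup_sum
    by (intro sum.cong refl) (auto simp: lookup_single when_def)
  then show ?thesis by (simp add: sum.delta in_keys_iff)
qed

lemma affine_bracket_loop:
  "affine_bracket (loop m x) (loop n y) =
     loop (m + n) (sl2_bracket x y)
     + affine_scale (if m = - n then of_int m * sl2_form x y else 0) central"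
proof -
  have "loop_bracket (Poly_Mapping.single m x) (Poly_Mapping.single n y) =
      Poly_Mapping.single (m + n) (sl2_bracket x y)"
    by (rule poly_mapping_eqI, subst lookup_loop_bracket[where S = "{m}"])
      (auto simp: lookup_single when_def)
  moreover have "loop_cocycle (Poly_Mapping.single m x) (Poly_Mapping.single n y) =
      (if m = - n then of_int m * sl2_form x y else 0)"
    by (subst loop_cocycle_superset[where S = "{m}"]) (auto simp: lookup_single when_def)
  ultimately show ?thesis
    by (simp add: affine_bracket_def loop_def central_def affine_scale_def)
qed

lemma affine_bracket_d: "affine_bracket degree_d (loop n x) = loop n (of_int n *s x)"
  by (auto simp: affine_bracket_def loop_def degree_d_def lookup_map_scale lookup_loop_deriv
      loop_bracket_def loop_cocycle_def lookup_add lookup_minus loop_deriv_def lookup_single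
      when_def intro!: poly_mapping_eqI)

lemma affine_bracket_central: "affine_bracket central x = 0" "affine_bracket x central = 0"
  by (auto simp: affine_bracket_def central_def loop_bracket_def loop_cocycle_def
      lookup_map_scale loop_deriv_def zero_prod_def split: prod.split intro!: poly_mapping_eqI)

lemma affine_bracket_0_right [simp]: "affine_bracket x 0 = 0"
  by (simp add: affine_bracket_def zero_prod_def loop_bracket_def loop_cocycle_def loop_deriv_def
      split: prod.split)

lemma affine_bracket_linear_left:
  "Vector_Spaces.linear affine_scale affine_scale (\<lambda>x. affine_bracket x y)"
proof unfold_locales
  fix x x' :: affine and s :: complex
  obtain p a b where x: "x = (p, a, b)" by (cases x)
  obtain p' a' b' where x': "x' = (p', a', b')" by (cases x')
  obtain q k l where y: "y = (q, k, l)" by (cases y)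
  define S where "S = keys p \<union> keys p'"
  have S: "finite S" "keys p \<subseteq> S" "keys p' \<subseteq> S" "keys (p + p') \<subseteq> S"
      "keys (Poly_Mapping.map ((*s) s) p) \<subseteq> S"
    using Poly_Mapping.keys_add[of p p'] by (auto simp: S_def in_keys_iff lookup_map_scale)
  note lb = lookup_loop_bracket[OF S(1)] and lc = loop_cocycle_superset[OF S(1)]
  have "loop_bracket (p + p') q = loop_bracket p q + loop_bracket p' q"
    by (rule poly_mapping_eqI, unfold lookup_add lb[OF S(2)] lb[OF S(3)] lb[OF S(4)])
      (simp add: sum.distrib[symmetric] sl2_bracket_def vec_eq_iff forall_3 algebra_simps)
  moreover have "loop_cocycle (p + p') q = loop_cocycle p q + loop_cocycle p' q"
    unfolding lookup_add lc[OF S(2)] lc[OF S(3)] lc[OF S(4)]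
    by (simp add: sum.distrib[symmetric] sl2_form_def algebra_simps)
  ultimately show "affine_bracket (x + x') y = affine_bracket x y + affine_bracket x' y"
    by (auto simp: x x' y affine_bracket_def lookup_add lookup_minus lookup_map_scale
        lookup_loop_deriv vec_eq_iff algebra_simps intro!: poly_mapping_eqI)
  have "loop_bracket (Poly_Mapping.map ((*s) s) p) q = Poly_Mapping.map ((*s) s) (loop_bracket p q)"
    by (rule poly_mapping_eqI, unfold lookup_map_scale lb[OF S(2)] lb[OF S(5)])
      (simp add: sum_distrib_left sl2_bracket_def vec_eq_iff forall_3 algebra_simps)
  moreover have "loop_cocycle (Poly_Mapping.map ((*s) s) p) q = s * loop_cocycle p q"
    unfolding lookup_map_scale lc[OF S(2)] lc[OF S(5)]
    by (simp add: sum_distrib_left sl2_form_def algebra_simps)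
  ultimately show "affine_bracket (affine_scale s x) y = affine_scale s (affine_bracket x y)"
    by (auto simp: x y affine_bracket_def affine_scale_def lookup_add lookup_minus lookup_map_scale
        lookup_loop_deriv vec_eq_iff algebra_simps intro!: poly_mapping_eqI)
qed

lemma affine_bracket_antisym: "affine_bracket x y = - affine_bracket y x"
proof -
  obtain p a b where x: "x = (p, a, b)" by (cases x)
  obtain q k l where y: "y = (q, k, l)" by (cases y)
  have "loop_bracket p q = - loop_bracket q p"
  proof (rule poly_mapping_eqI)
    fix n
    define S where "S = keys p \<union> (\<lambda>m. n - m) ` keys q"
    have S: "finite S" "keys p \<subseteq> S" by (auto simp: S_def)
    have T: "finite ((\<lambda>m. n - m) ` S)" "keys q \<subseteq> (\<lambda>m. n - m) ` S"
      by (auto simp: S_def image_Un image_image)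
    have "lookup (loop_bracket q p) n =
        (\<Sum>m\<in>S. sl2_bracket (lookup q (n - m)) (lookup p m))"
      unfolding lookup_loop_bracket[OF T] by (subst sum.reindex) (auto simp: inj_on_def)
    also have "\<dots> = - lookup (loop_bracket p q) n"
      unfolding lookup_loop_bracket[OF S] sum_negf[symmetric]
      by (intro sum.cong refl) (simp add: sl2_bracket_def vec_eq_iff forall_3)
    finally show "lookup (loop_bracket p q) n = lookup (- loop_bracket q p) n"
      by simp
  qed
  moreover have "loop_cocycle p q = - loop_cocycle q p"
  proof -
    define S where "S = keys p \<union> uminus ` keys q"
    have S: "finite S" "keys p \<subseteq> S" by (auto simp: S_def)
    have T: "finite (uminus ` S)" "keys q \<subseteq> uminus ` S"
      by (auto simp: S_def image_Un image_image)
    have "loop_cocycle q p = (\<Sum>m\<in>S. of_int (- m) * sl2_form (lookup q (- m)) (lookup p m))"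
      unfolding loop_cocycle_superset[OF T] by (subst sum.reindex) (auto simp: inj_on_def)
    also have "\<dots> = - loop_cocycle p q"
      unfolding loop_cocycle_superset[OF S] sum_negf[symmetric]
      by (intro sum.cong refl) (simp add: sl2_form_def algebra_simps)
    finally show ?thesis by simp
  qed
  ultimately show ?thesis
    by (auto simp: x y affine_bracket_def)
qed


section \<open>Chevalley generators and the Chevalley involution\<close>

text \<open>The index \<open>j\<close> ranges over \<open>{0, 1}\<close>.\<close>

definition chev_e :: "nat \<Rightarrow> affine" where
  "chev_e j = (if j = 0 then loop 1 sl2_f else loop 0 sl2_e)"

definition chev_f :: "nat \<Rightarrow> affine" where
  "chev_f j = (if j = 0 then loop (- 1) sl2_e else loop 0 sl2_f)"

definition chev_h :: "nat \<Rightarrow> affine" where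
  "chev_h j = (if j = 0 then central - loop 0 sl2_h else loop 0 sl2_h)"

definition sl2_theta :: "sl2 \<Rightarrow> sl2" where
  "sl2_theta x = vector [- (x $ 2), - (x $ 1), - (x $ 3)]"

definition chev_theta :: "affine \<Rightarrow> affine" where
  "chev_theta = (\<lambda>(p, a, b).
     (\<Sum>n\<in>keys p. Poly_Mapping.single (- n) (sl2_theta (lookup p n)), - a, - b))"

lemma sl2_theta_0 [simp]: "sl2_theta 0 = 0"
  by (simp add: sl2_theta_def vec_eq_iff forall_3)

lemma chev_theta_components:
  "lookup (fst (chev_theta x)) n = sl2_theta (lookup (fst x) (- n))"
  "fst (snd (chev_theta x)) = - fst (snd x)"
  "snd (snd (chev_theta x)) = - snd (snd x)"
proof -
  obtain p a b where x: "x = (p, a, b)" by (cases x)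
  have "lookup (fst (chev_theta x)) n =
      (\<Sum>k\<in>keys p. if k = - n then sl2_theta (lookup p k) else 0)"
    unfolding x chev_theta_def prod.case fst_conv lookup_sum
    by (intro sum.cong refl) (auto simp: lookup_single when_def)
  then show "lookup (fst (chev_theta x)) n = sl2_theta (lookup (fst x) (- n))"
    by (simp add: x in_keys_iff)
qed (simp_all add: chev_theta_def split: prod.split)

lemma affine_scale_components:
  "lookup (fst (affine_scale s x)) n = s *s lookup (fst x) n"
  "fst (snd (affine_scale s x)) = s * fst (snd x)"
  "snd (snd (affine_scale s x)) = s * snd (snd x)"
  by (simp_all add: affine_scale_def lookup_map_scale split: prod.split)

lemma affine_eqI:
  fixes x y :: affine
  assumes "\<And>n. lookup (fst x) n = lookup (fst y) n"
    and "fst (snd x) = fst (snd y)" "snd (snd x) = snd (snd y)"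
  shows "x = y"
  using assms by (intro prod_eqI poly_mapping_eqI)

lemma chev_theta_generators:
  "chev_theta (chev_e j) = - chev_f j"
  "chev_theta (chev_f j) = - chev_e j"
  "chev_theta (chev_h j) = - chev_h j"
  "chev_theta degree_d = - degree_d"
  by (rule affine_eqI; auto simp: chev_theta_components chev_e_def chev_f_def chev_h_def loop_def
      central_def degree_d_def lookup_single lookup_minus when_def sl2_theta_def
      sl2_e_def sl2_f_def sl2_h_def vec_eq_iff forall_3)+

lemma chev_theta_linear: "Vector_Spaces.linear affine_scale affine_scale chev_theta"
proof unfold_locales
  fix x y :: affine and s :: complex
  show "chev_theta (x + y) = chev_theta x + chev_theta y"
    by (rule affine_eqI)
      (auto simp: chev_theta_components lookup_add sl2_theta_def vec_eq_iff forall_3)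
  show "chev_theta (affine_scale s x) = affine_scale s (chev_theta x)"
    by (rule affine_eqI) (auto simp: chev_theta_components affine_scale_components
        sl2_theta_def vec_eq_iff forall_3)
qed

lemma chev_theta_bracket:
  "chev_theta (affine_bracket x y) = affine_bracket (chev_theta x) (chev_theta y)"
proof -
  obtain p a b where x: "x = (p, a, b)" by (cases x)
  obtain q k l where y: "y = (q, k, l)" by (cases y)
  define p' where "p' = fst (chev_theta x)"
  define q' where "q' = fst (chev_theta y)"
  have p': "lookup p' n = sl2_theta (lookup p (- n))" for n
    by (simp add: p'_def chev_theta_components x)
  have q': "lookup q' n = sl2_theta (lookup q (- n))" for n
    by (simp add: q'_def chev_theta_components y)
  have \<theta>: "chev_theta x = (p', - a, - b)" "chev_theta y = (q', - k, - l)"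
    by (simp_all add: p'_def q'_def x y chev_theta_def)
  define S where "S = keys p"
  have S: "finite S" "keys p \<subseteq> S" by (auto simp: S_def)
  have T: "finite (uminus ` S)" "keys p' \<subseteq> uminus ` S"
  proof -
    show "keys p' \<subseteq> uminus ` S"
    proof
      fix n assume "n \<in> keys p'"
      then have "- n \<in> S" by (auto simp: S_def in_keys_iff p')
      then show "n \<in> uminus ` S" by (rule rev_image_eqI) simp
    qed
  qed (simp add: S_def)
  have *: "lookup (loop_bracket p' q') n = sl2_theta (lookup (loop_bracket p q) (- n))" for n
  proof -
    have "lookup (loop_bracket p' q') n =
        (\<Sum>m\<in>S. sl2_theta (sl2_bracket (lookup p m) (lookup q (- n - m))))"
      unfolding lookup_loop_bracket[OF T]
      by (subst sum.reindex, simp, intro sum.cong refl sl2_eqI)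
        (simp_all add: p' q' sl2_theta_def sl2_bracket_def minus_diff_commute)
    then show ?thesis
      unfolding lookup_loop_bracket[OF S]
      by (intro sl2_eqI) (simp_all add: sl2_theta_def sum_negf)
  qed
  have "loop_cocycle p' q' = - loop_cocycle p q"
    unfolding loop_cocycle_superset[OF T] loop_cocycle_superset[OF S] sum_negf[symmetric]
    by (subst sum.reindex, simp, intro sum.cong refl)
      (simp add: p' q' sl2_theta_def sl2_form_def)
  then show ?thesis
    by (intro affine_eqI sl2_eqI; unfold chev_theta_components \<theta>; unfold x y)
      (simp_all add: affine_bracket_def lookup_add lookup_minus lookup_map_scale
        lookup_loop_deriv * p' q' sl2_theta_def)
qed

definition fixed_subalgebra :: "affine set" where
  "fixed_subalgebra = {x. chev_theta x = x}"

definition gen_B :: "nat \<Rightarrow> affine" where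
  "gen_B j = affine_scale \<i> (chev_e j - chev_f j)"

lemma gen_B_in_fixed_subalgebra: "gen_B j \<in> fixed_subalgebra"
proof -
  interpret Vector_Spaces.linear affine_scale affine_scale chev_theta
    by (rule chev_theta_linear)
  show ?thesis
    by (simp add: fixed_subalgebra_def gen_B_def scale diff chev_theta_generators)
qed

definition one_dim_rep :: "(affine \<Rightarrow> complex) \<Rightarrow> bool" where
  "one_dim_rep chi \<longleftrightarrow>
     (\<forall>x\<in>fixed_subalgebra. \<forall>y\<in>fixed_subalgebra. chi (x + y) = chi x + chi y) \<and>
     (\<forall>s. \<forall>x\<in>fixed_subalgebra. chi (affine_scale s x) = s * chi x) \<and>
     (\<forall>x\<in>fixed_subalgebra. \<forall>y\<in>fixed_subalgebra.
        chi (affine_bracket x y) = chi x * chi y - chi y * chi x)"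


section \<open>The Cartan subalgebra and weights\<close>

definition cartan :: "affine set" where
  "cartan = affine.span {chev_h 0, chev_h 1, degree_d}"

text \<open>A linear functional \<open>\<mu>\<close> on \<open>cartan\<close> is encoded by the vector
  \<open>(\<mu>(h\<^sub>0), \<mu>(h\<^sub>1), \<mu>(d))\<close> of its values on the basis; \<open>weight_eval \<mu> x\<close> is \<open>\<mu>(x)\<close>,
  meaningful for \<open>x \<in> cartan\<close> only.\<close>

type_synonym weight = "complex ^ 3"

definition weight_eval :: "weight \<Rightarrow> affine \<Rightarrow> complex" where
  "weight_eval \<mu> = (\<lambda>(p, a, b).
     lookup p 0 $ 3 * \<mu> $ 2 + a * (\<mu> $ 1 + \<mu> $ 2) + b * \<mu> $ 3)"

lemma weight_eval_basis:
  "weight_eval \<mu> (chev_h 0) = \<mu> $ 1"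
  "weight_eval \<mu> (chev_h 1) = \<mu> $ 2"
  "weight_eval \<mu> degree_d = \<mu> $ 3"
  by (simp_all add: weight_eval_def chev_h_def loop_def central_def degree_d_def sl2_h_def
      lookup_minus)

lemma weight_eval_linear: "Vector_Spaces.linear affine_scale (*) (weight_eval \<mu>)"
  by unfold_locales
    (auto simp: weight_eval_def affine_scale_def lookup_map_scale lookup_add algebra_simps)

definition simple_root :: "nat \<Rightarrow> weight" where
  "simple_root k = (if k = 0 then vector [2, - 2, 1] else vector [- 2, 2, 0])"

definition null_root :: weight where
  "null_root = simple_root 0 + simple_root 1"

definition fund_weight :: "nat \<Rightarrow> weight" where
  "fund_weight k = (if k = 0 then vector [1, 0, 0] else vector [0, 1, 0])"

definition weyl_vector :: weight where
  "weyl_vector = fund_weight 0 + fund_weight 1"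

definition cartan_form :: "affine \<Rightarrow> affine \<Rightarrow> complex" where
  "cartan_form = (\<lambda>(p, a, b) (q, a', b').
     2 * (lookup p 0 $ 3 * lookup q 0 $ 3) + a * b' + b * a')"

text \<open>The element of \<open>cartan\<close> that corresponds to \<open>\<mu>\<close> under \<open>cartan_form\<close>.\<close>

definition coweight :: "weight \<Rightarrow> affine" where
  "coweight \<mu> = affine_scale (weight_eval \<mu> (chev_h 1) / 2) (chev_h 1)
     + affine_scale (weight_eval \<mu> degree_d) central
     + affine_scale (weight_eval \<mu> central) degree_d"

lemma cartan_form_coweight: "cartan_form (coweight \<mu>) x = weight_eval \<mu> x"
  by (cases x) (simp add: cartan_form_def coweight_def weight_eval_def chev_h_def loop_def
      central_def degree_d_def affine_scale_def lookup_map_scale lookup_add sl2_h_def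
      algebra_simps)

definition weight_form :: "weight \<Rightarrow> weight \<Rightarrow> complex" where
  "weight_form \<mu> \<nu> = cartan_form (coweight \<mu>) (coweight \<nu>)"

definition weight_lattice :: "weight set" where
  "weight_lattice = {\<mu>. weight_eval \<mu> (chev_h 0) \<in> \<int> \<and> weight_eval \<mu> (chev_h 1) \<in> \<int>
     \<and> weight_eval \<mu> degree_d \<in> \<int>}"

definition level_lattice :: "int \<Rightarrow> weight set" where
  "level_lattice K = {\<mu> \<in> weight_lattice. weight_eval \<mu> central = of_int K}"

definition level_dominant :: "int \<Rightarrow> weight set" where
  "level_dominant K = {\<mu> \<in> level_lattice K. weight_eval \<mu> (chev_h 0) \<in> \<nat>
     \<and> weight_eval \<mu> (chev_h 1) \<in> \<nat> \<and> weight_eval \<mu> degree_d = 0}"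

definition level_spherical :: "int \<Rightarrow> (affine \<Rightarrow> complex) \<Rightarrow> weight set" where
  "level_spherical K chi = {\<mu> \<in> level_dominant K. \<forall>j\<in>{0, 1}. \<exists>m::nat.
     weight_eval \<mu> (chev_h j) - complex_of_real (cmod (chi (gen_B j))) = 2 * of_nat m}"


section \<open>Root space components\<close>

text \<open>\<open>root_component \<beta> x\<close> is the component of \<open>x\<close> of weight \<open>\<beta>\<close> under the adjoint action
  of \<open>cartan\<close>: the elements \<open>t\<^sup>n \<otimes> e\<close>, \<open>t\<^sup>n \<otimes> f\<close>, \<open>t\<^sup>n \<otimes> h\<close> have the weights
  \<open>n\<delta> + \<alpha>\<^sub>1\<close>, \<open>n\<delta> - \<alpha>\<^sub>1\<close>, \<open>n\<delta>\<close>, and \<open>c\<close>, \<open>d\<close> have weight \<open>0\<close>.\<close>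

definition root_component :: "weight \<Rightarrow> affine \<Rightarrow> affine" where
  "root_component \<beta> = (\<lambda>(p, a, b).
     (\<Sum>n\<in>keys p. Poly_Mapping.single n (vector
        [if \<beta> = of_int n *s null_root + simple_root 1 then lookup p n $ 1 else 0,
         if \<beta> = of_int n *s null_root - simple_root 1 then lookup p n $ 2 else 0,
         if \<beta> = of_int n *s null_root then lookup p n $ 3 else 0]),
      if \<beta> = 0 then a else 0,
      if \<beta> = 0 then b else 0))"


lemma root_component_components:
  "lookup (fst (root_component \<beta> x)) n = vector
     [if \<beta> = of_int n *s null_root + simple_root 1 then lookup (fst x) n $ 1 else 0,
      if \<beta> = of_int n *s null_root - simple_root 1 then lookup (fst x) n $ 2 else 0,
      if \<beta> = of_int n *s null_root then lookup (fst x) n $ 3 else 0]" (is "_ = ?r x n")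
  "fst (snd (root_component \<beta> x)) = (if \<beta> = 0 then fst (snd x) else 0)"
  "snd (snd (root_component \<beta> x)) = (if \<beta> = 0 then snd (snd x) else 0)"
proof -
  have "lookup (fst (root_component \<beta> x)) n =
      (\<Sum>m\<in>keys (fst x). if m = n then ?r x m else 0)"
    by (cases x) (auto simp: root_component_def lookup_sum lookup_single when_def intro!: sum.cong)
  then show "lookup (fst (root_component \<beta> x)) n = ?r x n"
    by (auto simp: in_keys_iff vec_eq_iff forall_3)
qed (simp_all add: root_component_def split: prod.split)

lemma root_component_in_root_space:
  assumes "h \<in> cartan"
  shows "affine_bracket h (root_component \<beta> x) =
    affine_scale (weight_eval \<beta> h) (root_component \<beta> x)"
proof -
  define r where "r = root_component \<beta> x"
  obtain p a b where r: "r = (p, a, b)" by (cases r)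
  interpret B: Vector_Spaces.linear affine_scale affine_scale "\<lambda>y. affine_bracket y r"
    by (rule affine_bracket_linear_left)
  interpret E: Vector_Spaces.linear affine_scale "(*)" "weight_eval \<beta>"
    by (rule weight_eval_linear)
  have p: "lookup p n = lookup (fst (root_component \<beta> x)) n" for n
    using r by (simp add: r_def)
  have ab: "a = fst (snd (root_component \<beta> x))" "b = snd (snd (root_component \<beta> x))"
    using r by (simp_all add: r_def)
  have lh: "affine_bracket (loop 0 sl2_h) r = affine_scale (\<beta> $ 2) r"
    unfolding r
    by (rule affine_eqI) (auto simp: affine_bracket_def loop_def affine_scale_def
        lookup_loop_bracket[where S = "{0}"] loop_cocycle_superset[where S = "{0}"] lookup_add
        lookup_minus lookup_map_scale lookup_loop_deriv p ab root_component_components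
        sl2_bracket_def sl2_h_def null_root_def simple_root_def vec_eq_iff forall_3 lookup_single)
  have d: "affine_bracket degree_d r = affine_scale (\<beta> $ 3) r"
    unfolding r
    by (rule affine_eqI) (auto simp: affine_bracket_def degree_d_def affine_scale_def
        loop_bracket_def loop_cocycle_def lookup_minus lookup_map_scale lookup_loop_deriv p ab
        root_component_components null_root_def simple_root_def vec_eq_iff forall_3)
  have z: "\<beta> $ 1 = - (\<beta> $ 2)" if "r \<noteq> 0"
  proof (rule ccontr)
    assume *: "\<beta> $ 1 \<noteq> - (\<beta> $ 2)"
    have "r = 0"
      by (rule affine_eqI) (use * in \<open>auto simp: r_def root_component_components null_root_def
        simple_root_def vec_eq_iff forall_3\<close>)
    then show False using that by simp
  qed
  have h0: "affine_bracket (chev_h 0) r = affine_scale (\<beta> $ 1) r"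
    using z by (cases "r = 0")
      (simp_all add: chev_h_def B.diff affine_bracket_central lh)
  have h1: "affine_bracket (chev_h 1) r = affine_scale (\<beta> $ 2) r"
    using lh by (simp add: chev_h_def)
  show ?thesis
    using assms unfolding cartan_def r_def[symmetric]
  proof (induction rule: affine.span_induct_alt)
    case base
    show ?case by (simp add: B.zero E.zero)
  next
    case (step s g y)
    then show ?case
      using h0 h1 d by (auto simp: B.add B.scale E.add E.scale weight_eval_basis
          affine.scale_left_distrib simp del: One_nat_def)
  qed
qed

lemma root_component_sum: "Sum_any (\<lambda>\<beta>. root_component \<beta> x) = x"
proof -
  define B where "B = insert 0 (\<Union>n\<in>keys (fst x). {of_int n *s null_root + simple_root 1,
    of_int n *s null_root - simple_root 1, of_int n *s null_root})"
  have B: "finite B" by (simp add: B_def)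
  have "root_component \<beta> x = 0" if "\<beta> \<notin> B" for \<beta>
  proof (rule affine_eqI)
    fix n
    show "lookup (fst (root_component \<beta> x)) n = lookup (fst 0) n"
      using that by (cases "n \<in> keys (fst x)")
        (auto simp: B_def root_component_components in_keys_iff vec_eq_iff[of "vector _"] forall_3)
  qed (use that in \<open>auto simp: B_def root_component_components\<close>)
  then have "Sum_any (\<lambda>\<beta>. root_component \<beta> x) = (\<Sum>\<beta>\<in>B. root_component \<beta> x)"
    by (intro Sum_any.expand_superset B) auto
  also have "\<dots> = x"
  proof (rule affine_eqI)
    fix n
    show "lookup (fst (\<Sum>\<beta>\<in>B. root_component \<beta> x)) n = lookup (fst x) n"
    proof (cases "n \<in> keys (fst x)")
      case True
      then have "of_int n *s null_root + simple_root 1 \<in> B"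
        "of_int n *s null_root - simple_root 1 \<in> B" "of_int n *s null_root \<in> B"
        by (auto simp: B_def)
      then show ?thesis
        using B by (intro sl2_eqI) (simp_all add: fst_sum lookup_sum root_component_components)
    next
      case False
      then show ?thesis
        using B
        by (intro sl2_eqI) (simp_all add: fst_sum lookup_sum root_component_components in_keys_iff)
    qed
  qed (use B in \<open>simp_all add: fst_sum snd_sum root_component_components, simp_all add: B_def\<close>)
  finally show ?thesis .
qed


section \<open>Integrable irreducible highest weight modules\<close>

locale affine_module = vector_space smul
  for smul :: "complex \<Rightarrow> 'v::ab_group_add \<Rightarrow> 'v" +
  fixes act :: "affine \<Rightarrow> 'v \<Rightarrow> 'v"
  assumes act_linear: "Vector_Spaces.linear smul smul (act x)"
    and linear_act: "Vector_Spaces.linear affine_scale smul (\<lambda>x. act x v)"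
    and act_bracket: "act (affine_bracket x y) v = act x (act y v) - act y (act x v)"

definition weight_space ::
    "(complex \<Rightarrow> 'v::ab_group_add \<Rightarrow> 'v) \<Rightarrow> (affine \<Rightarrow> 'v \<Rightarrow> 'v) \<Rightarrow> weight \<Rightarrow> 'v set" where
  "weight_space smul act \<mu> = {v. \<forall>h\<in>cartan. act h v = smul (weight_eval \<mu> h) v}"

context affine_module
begin

definition submodule :: "'v set \<Rightarrow> bool" where
  "submodule S \<longleftrightarrow> subspace S \<and> (\<forall>x. \<forall>v\<in>S. act x v \<in> S)"

definition irreducible :: bool where
  "irreducible \<longleftrightarrow> (UNIV :: 'v set) \<noteq> {0} \<and> (\<forall>S. submodule S \<longrightarrow> S = {0} \<or> S = UNIV)"

definition integrable :: bool where
  "integrable \<longleftrightarrow> span (\<Union>\<mu>. weight_space smul act \<mu>) = UNIV \<and>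
     (\<forall>j\<in>{0, 1}. \<forall>v. (\<exists>n. (act (chev_e j) ^^ n) v = 0) \<and> (\<exists>n. (act (chev_f j) ^^ n) v = 0))"

definition highest_weight_module :: "weight \<Rightarrow> bool" where
  "highest_weight_module lam \<longleftrightarrow> (\<exists>v. v \<noteq> 0 \<and> v \<in> weight_space smul act lam \<and>
     (\<forall>j\<in>{0, 1}. act (chev_e j) v = 0) \<and> (\<forall>S. submodule S \<and> v \<in> S \<longrightarrow> S = UNIV))"

end

text \<open>The module \<open>V(\<lambda>)\<close> is determined by this property up to isomorphism.\<close>

locale integrable_irreducible_hw_module = affine_module smul act
  for smul :: "complex \<Rightarrow> 'v::ab_group_add \<Rightarrow> 'v" and act :: "affine \<Rightarrow> 'v \<Rightarrow> 'v" +
  fixes lam :: weight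
  assumes irreducible: irreducible
    and integrable: integrable
    and highest_weight: "highest_weight_module lam"


section \<open>Completions and spherical vectors\<close>

text \<open>An element of \<open>\<Prod>\<^sub>\<mu> V\<^sub>\<mu>\<close> is the family of its components. The action of \<open>x\<close> on it is
  \<open>(x v)\<^sub>\<mu> = \<Sum>\<^sub>\<beta> x\<^sub>\<beta> v\<^bsub>\<mu>-\<beta>\<^esub>\<close>, a finite sum because \<open>x\<close> has only finitely many nonzero
  root space components.\<close>

definition completion ::
    "(complex \<Rightarrow> 'v::ab_group_add \<Rightarrow> 'v) \<Rightarrow> (affine \<Rightarrow> 'v \<Rightarrow> 'v) \<Rightarrow> (weight \<Rightarrow> 'v) set" where
  "completion smul act = {v. \<forall>\<mu>. v \<mu> \<in> weight_space smul act \<mu>}"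

definition completion_act ::
    "(affine \<Rightarrow> 'v::ab_group_add \<Rightarrow> 'v) \<Rightarrow> affine \<Rightarrow> (weight \<Rightarrow> 'v) \<Rightarrow> (weight \<Rightarrow> 'v)" where
  "completion_act act x v = (\<lambda>\<mu>. Sum_any (\<lambda>\<beta>. act (root_component \<beta> x) (v (\<mu> - \<beta>))))"

definition completion_spherical ::
    "(complex \<Rightarrow> 'v::ab_group_add \<Rightarrow> 'v) \<Rightarrow> (affine \<Rightarrow> 'v \<Rightarrow> 'v) \<Rightarrow> (affine \<Rightarrow> complex)
      \<Rightarrow> (weight \<Rightarrow> 'v) set" where
  "completion_spherical smul act chi = {v \<in> completion smul act.
     \<forall>x\<in>fixed_subalgebra. \<forall>\<mu>. completion_act act x v \<mu> = smul (chi x) (v \<mu>)}"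

text \<open>Likewise, an element of \<open>\<Prod>\<^sub>\<mu> V\<^sub>\<mu>\<^sup>*\<close> is the family of its components, where the values of
  \<open>f \<mu>\<close> off \<open>V\<^sub>\<mu>\<close> are irrelevant. The right action is determined by
  \<open>(f x)(v) = f (x v) = \<Sum>\<^sub>\<beta> f\<^bsub>\<mu>+\<beta>\<^esub> (x\<^sub>\<beta> v)\<close> for \<open>v \<in> V\<^sub>\<mu>\<close>.\<close>

definition dual_space :: "(complex \<Rightarrow> 'v::ab_group_add \<Rightarrow> 'v) \<Rightarrow> 'v set \<Rightarrow> ('v \<Rightarrow> complex) set"
  where
  "dual_space smul W = {f. (\<forall>v\<in>W. \<forall>w\<in>W. f (v + w) = f v + f w) \<and>
     (\<forall>s. \<forall>v\<in>W. f (smul s v) = s * f v)}"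

definition dual_completion ::
    "(complex \<Rightarrow> 'v::ab_group_add \<Rightarrow> 'v) \<Rightarrow> (affine \<Rightarrow> 'v \<Rightarrow> 'v) \<Rightarrow> (weight \<Rightarrow> 'v \<Rightarrow> complex) set"
  where
  "dual_completion smul act = {f. \<forall>\<mu>. f \<mu> \<in> dual_space smul (weight_space smul act \<mu>)}"

definition dual_completion_act ::
    "(affine \<Rightarrow> 'v::ab_group_add \<Rightarrow> 'v) \<Rightarrow> (weight \<Rightarrow> 'v \<Rightarrow> complex) \<Rightarrow> affine
      \<Rightarrow> (weight \<Rightarrow> 'v \<Rightarrow> complex)" where
  "dual_completion_act act f x = (\<lambda>\<mu> v. Sum_any (\<lambda>\<beta>. f (\<mu> + \<beta>) (act (root_component \<beta> x) v)))"

definition dual_completion_spherical ::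
    "(complex \<Rightarrow> 'v::ab_group_add \<Rightarrow> 'v) \<Rightarrow> (affine \<Rightarrow> 'v \<Rightarrow> 'v) \<Rightarrow> (affine \<Rightarrow> complex)
      \<Rightarrow> (weight \<Rightarrow> 'v \<Rightarrow> complex) set" where
  "dual_completion_spherical smul act chi = {f \<in> dual_completion smul act.
     \<forall>x\<in>fixed_subalgebra. \<forall>\<mu>. \<forall>v\<in>weight_space smul act \<mu>.
       dual_completion_act act f x \<mu> v = chi x * f \<mu> v}"

text \<open>An element of an algebraic tensor product \<open>A \<otimes> B\<close> is given as a finite sum
  \<open>\<Sum>\<^sub>i f\<^sub>i \<otimes> v\<^sub>i\<close> of pure tensors, i.e. as the list of the pairs \<open>(f\<^sub>i, v\<^sub>i) \<in> A \<times> B\<close>.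
  In \<open>Psi\<close> the summands \<open>f\<^sub>\<mu> \<otimes> v\<^sub>\<nu>\<close> with \<open>\<mu> \<noteq> \<nu>\<close> contribute nothing, as \<open>V\<^sub>\<mu>\<^sup>*\<close> vanishes on
  \<open>V\<^sub>\<nu>\<close>. Formal sums \<open>\<Sum>\<^sub>\<mu> a\<^sub>\<mu> e\<^sup>\<mu>\<close> are given by their coefficients.\<close>

definition Psi :: "((weight \<Rightarrow> 'v \<Rightarrow> complex) \<times> (weight \<Rightarrow> 'v)) list \<Rightarrow> weight \<Rightarrow> complex" where
  "Psi \<phi> = (\<lambda>\<nu>. \<Sum>(f, v)\<leftarrow>\<phi>. f \<nu> (v \<nu>))"


section \<open>Formal characters and their convergence\<close>

definition completed_group_algebra :: "(weight \<Rightarrow> complex) set" where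
  "completed_group_algebra = {a.
     (\<forall>\<mu>. a \<mu> \<noteq> 0 \<longrightarrow> \<mu> \<in> weight_lattice) \<and>
     finite {K. \<exists>\<mu>\<in>level_lattice K. a \<mu> \<noteq> 0} \<and>
     (\<forall>K. \<forall>N::real. finite {\<mu> \<in> level_lattice K. a \<mu> \<noteq> 0 \<and> Re (weight_form \<mu> weyl_vector) \<ge> N})}"

definition Y_space :: "(complex \<times> complex \<times> complex) set" where
  "Y_space = {(z, u, \<tau>). Im \<tau> > 0}"

text \<open>Here \<open>\<mu> = c\<^sub>1 \<alpha>\<^sub>1 + K \<varpi>\<^sub>0 + n \<delta>\<close> with \<open>c\<^sub>1 = \<mu>(h\<^sub>1) / 2\<close>, \<open>K = \<mu>(c)\<close>, \<open>n = \<mu>(d)\<close>.\<close>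

definition weight_exp :: "weight \<Rightarrow> complex \<times> complex \<times> complex \<Rightarrow> complex" where
  "weight_exp \<mu> = (\<lambda>(z, u, \<tau>).
     let c1 = weight_eval \<mu> (chev_h 1) / 2; K = weight_eval \<mu> central; n = weight_eval \<mu> degree_d
     in exp (of_real pi * \<i> * (2 * c1 * z + K * u - n * \<tau>)))"

lemma weight_exp_coords:
  "weight_exp (c1 *s simple_root 1 + K *s fund_weight 0 + n *s null_root) (z, u, \<tau>) =
     exp (of_real pi * \<i> * (2 * c1 * z + K * u - n * \<tau>))"
  by (simp add: weight_exp_def Let_def weight_eval_basis weight_eval_def central_def
      chev_h_def degree_d_def loop_def sl2_h_def
      simple_root_def fund_weight_def null_root_def)

lemma weight_coords:
  "\<mu> = (\<mu> $ 2 / 2) *s simple_root 1 + (\<mu> $ 1 + \<mu> $ 2) *s fund_weight 0 + (\<mu> $ 3) *s null_root"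
  by (simp add: simple_root_def fund_weight_def null_root_def vec_eq_iff forall_3)

text \<open>Convergence of the family of functions is unconditional: uniform convergence refers to the
  net of all finite partial sums.\<close>

definition converges_on ::
    "(weight \<Rightarrow> complex) \<Rightarrow> (complex \<times> complex \<times> complex) set \<Rightarrow> bool" where
  "converges_on a U \<longleftrightarrow> a \<in> completed_group_algebra \<and> open U \<and> U \<subseteq> Y_space \<and>
     (\<forall>y\<in>U. (\<lambda>\<mu>. norm (a \<mu> * weight_exp \<mu> y)) summable_on weight_lattice) \<and>
     (\<forall>y\<in>U. \<exists>W. open W \<and> y \<in> W \<and> W \<subseteq> U \<and>
        uniform_limit W (\<lambda>F x. \<Sum>\<mu>\<in>F. a \<mu> * weight_exp \<mu> x)
          (\<lambda>x. \<Sum>\<^sub>\<infinity>\<mu>\<in>weight_lattice. a \<mu> * weight_exp \<mu> x)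
          (finite_subsets_at_top weight_lattice))"

definition D_region :: "(complex \<times> complex \<times> complex) set" where
  "D_region = {(z, u, \<tau>) \<in> Y_space. - Im \<tau> / 2 < Im z \<and> Im z < 0}"

end

theory Submission
  imports Defs
begin

text \<open>
  For a pair \<open>(\<phi>, v)\<close> of spherical vectors write \<open>a\<^sub>\<nu> = \<phi>\<^sub>\<nu>(v\<^sub>\<nu>)\<close>, where
  \<open>\<nu> = \<lambda> - m \<alpha>\<^sub>0 - n \<alpha>\<^sub>1\<close> has depth \<open>m + n\<close>. Convergence rests on two facts: the coefficients grow
  at most exponentially with the depth, \<open>|a\<^sub>\<nu>| \<le> C R\<^bsup>m+n\<^esup>\<close> (\<open>coefficient_bound\<close>), and the weights of
  \<open>V(\<lambda>)\<close> lie in the paraboloid \<open>(m - n)\<^sup>2 \<le> \<lambda>(h\<^sub>0) m + \<lambda>(h\<^sub>1) n\<close> (\<open>weights_in_paraboloid\<close>). On \<open>D\<close> the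
  function \<open>e\<^sup>\<nu>\<close> has absolute value \<open>exp(- \<pi> (m (Im \<tau> + 2 Im z) - 2 n Im z))\<close> up to a factor that is
  independent of \<open>m\<close> and \<open>n\<close>. The two positive numbers \<open>Im \<tau> + 2 Im z\<close> and \<open>- 2 Im z\<close> have the sum
  \<open>Im \<tau>\<close>, but either of them may be close to \<open>0\<close>, so that \<open>e\<^sup>\<nu>\<close> need not decay fast enough in one of
  the directions \<open>m\<close>, \<open>n\<close>. This is where the paraboloid enters: \<open>m - n\<close> is at most of the
  order of \<open>sqrt (m + n)\<close>, so \<open>e\<^sup>\<nu>\<close> decays at least like \<open>exp(- \<pi> (m + n) Im \<tau> / 4)\<close>, and this beats \<open>R\<^bsup>m+n\<^esup>\<close> as
  soon as \<open>Im \<tau>\<close> is large (\<open>converges_on_of_exponential_bound\<close>).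

  The exponential bound comes from the Casimir operator, which acts on \<open>V(\<lambda>)\<close> as a scalar
  (\<open>casimir_scalar\<close>). Evaluated on \<open>v\<^sub>\<nu>\<close> this says that \<open>|\<lambda> + \<rho>|\<^sup>2 - |\<nu> + \<rho>|\<^sup>2\<close> times \<open>v\<^sub>\<nu>\<close> is a sum over the
  positive roots \<open>\<beta>\<close> of terms \<open>f\<^sub>\<beta> e\<^sub>\<beta> v\<^sub>\<nu>\<close> (\<open>casimir_recursion\<close>); the paraboloid condition shows that the
  factor is at least \<open>2 (m + n)\<close>. For every \<open>\<beta>\<close> the subalgebra \<open>k\<close> contains \<open>e\<^sub>\<beta> - f\<^sub>\<beta>\<close>. Sphericity of
  \<open>v\<close> and of \<open>\<phi>\<close> therefore trades \<open>e\<^sub>\<beta>\<close> for \<open>f\<^sub>\<beta>\<close> on either side of the pairing, which expresses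
  \<open>\<phi>\<^sub>\<nu>(f\<^sub>\<beta> e\<^sub>\<beta> v\<^sub>\<nu>)\<close> through the coefficients \<open>a\<^bsub>\<nu>+k\<beta>\<^esub>\<close> with \<open>k \<ge> 1\<close> of smaller depth (\<open>root_string_bound\<close>).
  If these obey the bound \<open>C R\<^bsup>depth\<^esup>\<close>, then the term of \<open>\<beta>\<close> is at most a constant times
  \<open>(m + n) C R\<^bsup>m+n\<^esup> R\<^bsup>-ht \<beta>\<^esup>\<close>. The sum over \<open>\<beta>\<close> is a geometric series of size \<open>1 / R\<close>, the factor \<open>m + n\<close>
  cancels, and for large \<open>R\<close> the bound persists by induction on the depth.
\<close>

section \<open>Brackets in the loop algebra\<close>

lemma loop_scale: "loop n (s *s x) = affine_scale s (loop n x)"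
  by (rule affine_eqI)
    (auto simp: loop_def affine_scale_components lookup_single when_def)

lemma loop_zero: "loop n 0 = 0"
  by (simp add: loop_def zero_prod_def)

lemma loop_minus: "loop n (- x) = - loop n x"
  by (simp add: loop_def single_uminus)

lemma sl2_bracket_basis:
  "sl2_bracket sl2_e sl2_f = sl2_h"
  "sl2_bracket sl2_f sl2_e = (-1) *s sl2_h"
  "sl2_bracket sl2_h sl2_e = 2 *s sl2_e"
  "sl2_bracket sl2_e sl2_h = (-2) *s sl2_e"
  "sl2_bracket sl2_h sl2_f = (-2) *s sl2_f"
  "sl2_bracket sl2_f sl2_h = 2 *s sl2_f"
  "sl2_bracket sl2_e sl2_e = 0" "sl2_bracket sl2_f sl2_f = 0" "sl2_bracket sl2_h sl2_h = 0"
  by (auto simp: sl2_bracket_def sl2_e_def sl2_f_def sl2_h_def intro!: sl2_eqI)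

lemma sl2_form_basis:
  "sl2_form sl2_e sl2_f = 1" "sl2_form sl2_f sl2_e = 1" "sl2_form sl2_h sl2_h = 2"
  "sl2_form sl2_e sl2_e = 0" "sl2_form sl2_f sl2_f = 0" "sl2_form sl2_h sl2_e = 0"
  "sl2_form sl2_e sl2_h = 0" "sl2_form sl2_h sl2_f = 0" "sl2_form sl2_f sl2_h = 0"
  by (simp_all add: sl2_form_def sl2_e_def sl2_f_def sl2_h_def)

lemmas bracket_loop_basis =
  affine_bracket_loop sl2_bracket_basis sl2_form_basis loop_scale loop_zero loop_minus

lemma affine_expand:
  "(p, a, b) = (\<Sum>n\<in>keys p. affine_scale (lookup p n $ 1) (loop n sl2_e)
       + affine_scale (lookup p n $ 2) (loop n sl2_f)
       + affine_scale (lookup p n $ 3) (loop n sl2_h))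
     + affine_scale a central + affine_scale b degree_d"
proof (rule affine_eqI)
  fix k
  have *: "lookup (fst (affine_scale (lookup p n $ 1) (loop n sl2_e)
       + affine_scale (lookup p n $ 2) (loop n sl2_f)
       + affine_scale (lookup p n $ 3) (loop n sl2_h))) k = (if n = k then lookup p n else 0)" for n
    by (rule sl2_eqI) (auto simp: lookup_add affine_scale_components loop_def lookup_single when_def
        sl2_e_def sl2_f_def sl2_h_def)
  have **: "lookup (fst (affine_scale a central)) k = 0"
    "lookup (fst (affine_scale b degree_d)) k = 0"
    by (simp_all add: affine_scale_components central_def degree_d_def)
  show "lookup (fst (p, a, b)) k = lookup (fst ((\<Sum>n\<in>keys p.
       affine_scale (lookup p n $ 1) (loop n sl2_e)
       + affine_scale (lookup p n $ 2) (loop n sl2_f)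
       + affine_scale (lookup p n $ 3) (loop n sl2_h))
     + affine_scale a central + affine_scale b degree_d)) k"
    unfolding fst_add fst_sum lookup_add lookup_sum ** *[unfolded fst_add lookup_add]
    by (simp add: sum.delta in_keys_iff)
qed (simp_all add: fst_sum snd_sum affine_scale_components central_def degree_d_def loop_def)

context affine_module
begin

lemma act_hom [simp]:
  "act x (u + w) = act x u + act x w" "act x (u - w) = act x u - act x w"
  "act x (- u) = - act x u" "act x 0 = 0" "act x (smul s u) = smul s (act x u)"
  "act x (sum g A) = (\<Sum>i\<in>A. act x (g i))"
proof -
  interpret A: Vector_Spaces.linear smul smul "act x" by (rule act_linear)
  show "act x (u + w) = act x u + act x w" "act x (u - w) = act x u - act x w"
  "act x (- u) = - act x u" "act x 0 = 0" "act x (smul s u) = smul s (act x u)"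
  "act x (sum g A) = (\<Sum>i\<in>A. act x (g i))"
    by (rule A.add A.diff A.neg A.zero A.scale A.sum)+
qed

lemma act_hom_left [simp]:
  "act (x + y) u = act x u + act y u" "act (x - y) u = act x u - act y u"
  "act (- x) u = - act x u" "act 0 u = 0" "act (affine_scale s x) u = smul s (act x u)"
  "act (sum g A) u = (\<Sum>i\<in>A. act (g i) u)"
proof -
  interpret A: Vector_Spaces.linear affine_scale smul "\<lambda>x. act x u" by (rule linear_act)
  show "act (x + y) u = act x u + act y u" "act (x - y) u = act x u - act y u"
  "act (- x) u = - act x u" "act 0 u = 0" "act (affine_scale s x) u = smul s (act x u)"
  "act (sum g A) u = (\<Sum>i\<in>A. act (g i) u)"
    by (rule A.add A.diff A.neg A.zero A.scale A.sum)+
qed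

abbreviation opE :: "int \<Rightarrow> 'v \<Rightarrow> 'v" where "opE n \<equiv> act (loop n sl2_e)"
abbreviation opF :: "int \<Rightarrow> 'v \<Rightarrow> 'v" where "opF n \<equiv> act (loop n sl2_f)"
abbreviation opH :: "int \<Rightarrow> 'v \<Rightarrow> 'v" where "opH n \<equiv> act (loop n sl2_h)"

lemma act_commute: "act x (act y u) = act y (act x u) + act (affine_bracket x y) u"
  by (simp add: act_bracket)

lemma opE_opF: "opE m (opF n u) = opF n (opE m u) + opH (m + n) u
    + smul (if m = - n then of_int m else 0) (act central u)"
  by (subst act_commute) (simp add: bracket_loop_basis add.assoc)

lemma opH_opE: "opH m (opE n u) = opE n (opH m u) + smul 2 (opE (m + n) u)"
  by (subst act_commute) (simp add: bracket_loop_basis add.assoc)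

lemma opH_opF: "opH m (opF n u) = opF n (opH m u) - smul 2 (opF (m + n) u)"
  by (subst act_commute) (simp add: bracket_loop_basis add.assoc)

lemma opH_opH: "opH m (opH n u) = opH n (opH m u)
    + smul (if m = - n then 2 * of_int m else 0) (act central u)"
  by (subst act_commute) (simp add: bracket_loop_basis add.assoc mult.commute)

lemma opE_opE: "opE m (opE n u) = opE n (opE m u)"
  by (subst act_commute) (simp add: bracket_loop_basis add.assoc)

lemma opF_opF: "opF m (opF n u) = opF n (opF m u)"
  by (subst act_commute) (simp add: bracket_loop_basis add.assoc)

lemma d_loop: "act degree_d (act (loop n x) u) =
    act (loop n x) (act degree_d u) + smul (of_int n) (act (loop n x) u)"
  by (subst act_commute) (simp add: affine_bracket_d loop_scale)

lemma central_commute: "act central (act x u) = act x (act central u)"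
  by (subst act_commute) (simp add: affine_bracket_central)

lemma bracket_chev_e_f:
  "affine_bracket (chev_e i) (chev_f j) = (if (i = 0) = (j = 0) then chev_h i else 0)"
proof -
  have "affine_scale (- 1) (loop 0 sl2_h) + affine_scale 1 central = central - loop 0 sl2_h"
    by (simp add: affine.scale_minus_left)
  then show ?thesis
    by (auto simp: chev_e_def chev_f_def chev_h_def bracket_loop_basis)
qed

lemma smul_two: "smul 2 u = u + u"
  using scale_left_distrib[of 1 1 u] by simp

text \<open>The Chevalley generators and \<open>d\<close> generate the Lie algebra: brackets of \<open>e\<^sub>j\<close>, \<open>f\<^sub>j\<close> give the modes
  \<open>-1\<close>, \<open>0\<close>, \<open>1\<close> and \<open>c\<close>, and bracketing with the modes \<open>1\<close> and \<open>-1\<close> then moves through all modes.\<close>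

lemma submoduleI:
  assumes S: "subspace S"
    and ef: "\<And>j u. u \<in> S \<Longrightarrow> act (chev_e j) u \<in> S" "\<And>j u. u \<in> S \<Longrightarrow> act (chev_f j) u \<in> S"
    and d: "\<And>u. u \<in> S \<Longrightarrow> act degree_d u \<in> S"
  shows "submodule S"
proof -
  define St where "St x \<longleftrightarrow> (\<forall>u\<in>S. act x u \<in> S)" for x
  have br: "St (affine_bracket x y)" if "St x" "St y" for x y
    using that S by (auto simp: St_def act_bracket intro!: subspace_diff)
  have add: "St (x + y)" if "St x" "St y" for x y
    using that S by (auto simp: St_def intro!: subspace_add)
  have sc: "St (affine_scale s x)" if "St x" for s x
    using that S by (auto simp: St_def intro!: subspace_scale)
  have unsc: "St x" if "St (affine_scale s x)" "s \<noteq> 0" for s x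
    using sc[OF that(1), of "inverse s"] that(2) by simp
  have e0: "St (loop 0 sl2_e)" and f0: "St (loop 0 sl2_f)"
    using ef(1)[of _ 1] ef(2)[of _ 1] by (auto simp: St_def chev_e_def chev_f_def)
  have f1: "St (loop 1 sl2_f)" and em1: "St (loop (-1) sl2_e)"
    using ef(1)[of _ 0] ef(2)[of _ 0] by (auto simp: St_def chev_e_def chev_f_def)
  have h0: "St (loop 0 sl2_h)"
    using br[OF e0 f0] by (simp add: bracket_loop_basis)
  have h1: "St (loop 1 sl2_h)"
    using br[OF e0 f1] by (simp add: bracket_loop_basis)
  have hm1: "St (loop (-1) sl2_h)"
    using unsc[of "-1"] br[OF f0 em1] by (simp add: bracket_loop_basis)
  have e1: "St (loop 1 sl2_e)"
    using unsc[of 2 "loop 1 sl2_e"] br[OF h1 e0] by (simp add: bracket_loop_basis)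
  have fm1: "St (loop (-1) sl2_f)"
    using unsc[of "-2" "loop (-1) sl2_f"] br[OF hm1 f0] by (simp add: bracket_loop_basis)
  have c: "St central"
  proof -
    have "affine_bracket (loop 1 sl2_f) (loop (-1) sl2_e) = central - loop 0 sl2_h"
      by (simp add: bracket_loop_basis)
    then show ?thesis
      using add[OF br[OF f1 em1] h0] by simp
  qed
  have up: "St (loop (int n) sl2_e) \<and> St (loop (int n) sl2_f) \<and> St (loop (int n) sl2_h)" for n
  proof (induction n)
    case (Suc n)
    then have IH: "St (loop (int n) sl2_e)" "St (loop (int n) sl2_f)" by auto
    have "St (affine_scale 2 (loop (int (Suc n)) sl2_e))"
      using br[OF h1 IH(1)] by (simp add: bracket_loop_basis)
    moreover have "St (affine_scale (-2) (loop (int (Suc n)) sl2_f))"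
      using br[OF h1 IH(2)] by (simp add: bracket_loop_basis)
    moreover have "St (loop (int (Suc n)) sl2_h)"
      using br[OF e1 IH(2)] by (simp add: bracket_loop_basis split: if_splits)
    ultimately show ?case
      using unsc[of 2 "loop _ sl2_e"] unsc[of "-2" "loop _ sl2_f"] by auto
  qed (use e0 f0 h0 in auto)
  have down: "St (loop (- int n) sl2_e) \<and> St (loop (- int n) sl2_f) \<and> St (loop (- int n) sl2_h)" for n
  proof (induction n)
    case (Suc n)
    then have IH: "St (loop (- int n) sl2_e)" "St (loop (- int n) sl2_f)" by auto
    have "St (affine_scale 2 (loop (- int (Suc n)) sl2_e))"
      using br[OF hm1 IH(1)] by (simp add: bracket_loop_basis)
    moreover have "St (affine_scale (-2) (loop (- int (Suc n)) sl2_f))"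
      using br[OF hm1 IH(2)] by (simp add: bracket_loop_basis)
    moreover have "St (loop (- int (Suc n)) sl2_h)"
      using br[OF em1 IH(2)] by (simp add: bracket_loop_basis split: if_splits)
    ultimately show ?case
      using unsc[of 2 "loop _ sl2_e"] unsc[of "-2" "loop _ sl2_f"] by auto
  qed (use e0 f0 h0 in auto)
  have all: "St (loop n sl2_e)" "St (loop n sl2_f)" "St (loop n sl2_h)" for n
    using up[of "nat n"] down[of "nat (- n)"] by (cases "n \<ge> 0"; simp)+
  have dd: "St degree_d" using d by (simp add: St_def)
  have sm: "St (sum g A)" if "\<And>i. St (g i)" for g :: "int \<Rightarrow> affine" and A
    using that S by (auto simp: St_def intro!: subspace_sum)
  have "St x" for x
  proof -
    obtain p a b where x: "x = (p, a, b)" by (cases x)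
    show ?thesis
      unfolding x by (subst affine_expand) (intro add sc sm all c dd)
  qed
  then show ?thesis
    using S by (auto simp: submodule_def St_def)
qed

end

section \<open>Weight spaces\<close>

lemma null_root_entries: "null_root $ 1 = 0" "null_root $ 2 = 0" "null_root $ 3 = 1"
  by (simp_all add: null_root_def simple_root_def)

lemma simple_root_entries:
  "simple_root j $ 1 = (if j = 0 then 2 else - 2)"
  "simple_root j $ 2 = (if j = 0 then - 2 else 2)"
  "simple_root j $ 3 = (if j = 0 then 1 else 0)"
  by (simp_all add: simple_root_def)

context affine_module
begin

lemma weight_space_iff:
  "u \<in> weight_space smul act \<mu> \<longleftrightarrow>
     act (chev_h 0) u = smul (\<mu> $ 1) u \<and> act (chev_h 1) u = smul (\<mu> $ 2) u \<and>
     act degree_d u = smul (\<mu> $ 3) u" (is "?L \<longleftrightarrow> ?R")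
proof
  assume ?L
  moreover have "chev_h 0 \<in> cartan" "chev_h 1 \<in> cartan" "degree_d \<in> cartan"
    unfolding cartan_def by (rule affine.span_base, simp)+
  ultimately show ?R
    unfolding weight_space_def using weight_eval_basis[of \<mu>] by fastforce
next
  assume R: ?R
  interpret E: Vector_Spaces.linear affine_scale "(*)" "weight_eval \<mu>"
    by (rule weight_eval_linear)
  have "act h u = smul (weight_eval \<mu> h) u" if "h \<in> cartan" for h
    using that unfolding cartan_def
  proof (induction rule: affine.span_induct_alt)
    case base
    then show ?case by (simp add: E.zero)
  next
    case (step c x y)
    then show ?case
      using R by (auto simp: E.add E.scale weight_eval_basis scale_left_distrib simp del: One_nat_def)
  qed
  then show ?L
    by (simp add: weight_space_def)
qed

lemma subspace_weight_space: "subspace (weight_space smul act \<mu>)"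
  unfolding subspace_def Ball_def weight_space_iff
  by (simp add: scale_right_distrib mult.commute)

lemma weight_space_zero: "0 \<in> weight_space smul act \<mu>"
  using subspace_weight_space subspace_0 by blast

lemma weight_space_shift:
  assumes "affine_bracket (chev_h 0) x = affine_scale (\<beta> $ 1) x"
    and "affine_bracket (chev_h 1) x = affine_scale (\<beta> $ 2) x"
    and "affine_bracket degree_d x = affine_scale (\<beta> $ 3) x"
    and "u \<in> weight_space smul act \<mu>"
  shows "act x u \<in> weight_space smul act (\<mu> + \<beta>)"
  using assms(4) unfolding weight_space_iff
  by (auto simp: act_commute[of "chev_h 0" x] act_commute[of "chev_h (Suc 0)" x]
      act_commute[of degree_d x] assms(1-3)[simplified] scale_left_distrib)

lemma bracket_chev_h_0: "affine_bracket (chev_h 0) x = - affine_bracket (loop 0 sl2_h) x"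
proof -
  interpret B: Vector_Spaces.linear affine_scale affine_scale "\<lambda>y. affine_bracket y x"
    by (rule affine_bracket_linear_left)
  show ?thesis
    by (simp add: chev_h_def B.diff affine_bracket_central)
qed

lemma chev_h_1: "chev_h (Suc 0) = loop 0 sl2_h"
  by (simp add: chev_h_def)

lemma opE_weight:
  "u \<in> weight_space smul act \<mu> \<Longrightarrow>
     opE n u \<in> weight_space smul act (\<mu> + (of_int n *s null_root + simple_root 1))"
  by (rule weight_space_shift)
    (simp_all add: bracket_chev_h_0 chev_h_1 bracket_loop_basis affine_bracket_d
      null_root_entries simple_root_entries)

lemma opF_weight:
  "u \<in> weight_space smul act \<mu> \<Longrightarrow>
     opF n u \<in> weight_space smul act (\<mu> + (of_int n *s null_root - simple_root 1))"
  by (rule weight_space_shift)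
    (simp_all add: bracket_chev_h_0 chev_h_1 bracket_loop_basis affine_bracket_d
      null_root_entries simple_root_entries)

lemma opH_weight:
  "u \<in> weight_space smul act \<mu> \<Longrightarrow>
     opH n u \<in> weight_space smul act (\<mu> + of_int n *s null_root)"
  by (rule weight_space_shift)
    (simp_all add: bracket_chev_h_0 chev_h_1 bracket_loop_basis affine_bracket_d
      null_root_entries)

lemma chev_e_weight:
  "u \<in> weight_space smul act \<mu> \<Longrightarrow> act (chev_e j) u \<in> weight_space smul act (\<mu> + simple_root j)"
  using opE_weight[of u \<mu> 0] opF_weight[of u \<mu> 1]
  by (auto simp: chev_e_def null_root_def simple_root_def)

lemma chev_f_weight:
  "u \<in> weight_space smul act \<mu> \<Longrightarrow> act (chev_f j) u \<in> weight_space smul act (\<mu> - simple_root j)"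
  using opF_weight[of u \<mu> 0] opE_weight[of u \<mu> "-1"]
  by (auto simp: chev_f_def null_root_def simple_root_def)

lemma chev_h_weight:
  "u \<in> weight_space smul act \<mu> \<Longrightarrow>
    act (chev_h j) u = smul (if j = 0 then \<mu> $ 1 else \<mu> $ 2) u"
  by (auto simp: weight_space_iff chev_h_def)

text \<open>Eigenvectors for distinct weights are linearly independent: \<open>h - \<mu>(h)\<close> kills the
  component of weight \<open>\<mu>\<close> and scales the others.\<close>

lemma weight_vectors_independent:
  assumes "finite F" "\<And>\<mu>. \<mu> \<in> F \<Longrightarrow> g \<mu> \<in> weight_space smul act \<mu>" "sum g F = 0"
  shows "\<forall>\<mu>\<in>F. g \<mu> = 0"
  using assms
proof (induction F arbitrary: g rule: finite_induct)
  case (insert \<mu>0 F)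
  have *: "\<forall>\<mu>\<in>F. smul (s \<mu> - s \<mu>0) (g \<mu>) = 0"
    if h: "\<And>\<mu>. \<mu> \<in> insert \<mu>0 F \<Longrightarrow> act h (g \<mu>) = smul (s \<mu>) (g \<mu>)" for h s
  proof (rule insert.IH)
    have "0 = act h (sum g (insert \<mu>0 F)) - smul (s \<mu>0) (sum g (insert \<mu>0 F))"
      using insert.prems(2) by simp
    also have "\<dots> = (\<Sum>\<mu>\<in>F. act h (g \<mu>) - smul (s \<mu>0) (g \<mu>))"
      using insert.hyps h by (simp add: scale_right_distrib scale_sum_right sum_subtractf)
    also have "\<dots> = (\<Sum>\<mu>\<in>F. smul (s \<mu> - s \<mu>0) (g \<mu>))"
      using h by (intro sum.cong) (auto simp: scale_left_diff_distrib)
    finally show "(\<Sum>\<mu>\<in>F. smul (s \<mu> - s \<mu>0) (g \<mu>)) = 0" by simp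
  qed (use insert.prems subspace_weight_space subspace_scale in auto)
  have w: "act (chev_h 0) (g \<mu>) = smul (\<mu> $ 1) (g \<mu>)" "act (chev_h 1) (g \<mu>) = smul (\<mu> $ 2) (g \<mu>)"
    "act degree_d (g \<mu>) = smul (\<mu> $ 3) (g \<mu>)" if "\<mu> \<in> insert \<mu>0 F" for \<mu>
    using insert.prems(1)[OF that] by (auto simp: weight_space_iff)
  have z: "g \<mu> = 0" if "\<mu> \<in> F" for \<mu>
  proof -
    have "\<mu> \<noteq> \<mu>0" using that insert.hyps by auto
    then obtain i where i: "\<mu> $ i \<noteq> \<mu>0 $ i" by (auto simp: vec_eq_iff)
    have "smul (\<mu> $ i - \<mu>0 $ i) (g \<mu>) = 0"
      using *[of "chev_h 0" "\<lambda>\<mu>. \<mu> $ 1"] *[of "chev_h 1" "\<lambda>\<mu>. \<mu> $ 2"]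
        *[of degree_d "\<lambda>\<mu>. \<mu> $ 3"] w that
      using exhaust_3[of i] by auto
    then show ?thesis using i by simp
  qed
  then have "g \<mu>0 = 0"
    using insert.prems(2) insert.hyps by simp
  with z show ?case by auto
qed simp

lemma span_weight_spaces:
  assumes "u \<in> span (\<Union>\<mu>\<in>I. weight_space smul act \<mu>)"
  shows "\<exists>F g. finite F \<and> F \<subseteq> I \<and> (\<forall>\<mu>. g \<mu> \<in> weight_space smul act \<mu>) \<and> (\<forall>\<mu>. \<mu> \<notin> F \<longrightarrow> g \<mu> = 0)
    \<and> u = sum g F"
  using assms
proof (induction rule: span_induct_alt)
  case base
  show ?case by (rule exI[of _ "{}"], rule exI[of _ "\<lambda>_. 0"]) (simp add: weight_space_zero)
next
  case (step c x y)
  then obtain F g \<mu> where F: "finite F" "F \<subseteq> I" "\<forall>\<mu>. g \<mu> \<in> weight_space smul act \<mu>"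
    "\<forall>\<mu>. \<mu> \<notin> F \<longrightarrow> g \<mu> = 0" "y = sum g F" and \<mu>: "\<mu> \<in> I" "x \<in> weight_space smul act \<mu>"
    by blast
  define g' where "g' \<nu> = (if \<nu> = \<mu> then smul c x + g \<mu> else g \<nu>)" for \<nu>
  have "sum g' (insert \<mu> F) = smul c x + sum g (insert \<mu> F)"
    using F(1) by (simp add: g'_def sum.insert_remove add.assoc)
  also have "sum g (insert \<mu> F) = y"
    using F by (cases "\<mu> \<in> F") (auto simp: insert_absorb)
  finally have "smul c x + y = sum g' (insert \<mu> F)" by simp
  moreover have "\<forall>\<nu>. g' \<nu> \<in> weight_space smul act \<nu>"
    using F(3) \<mu>(2) subspace_weight_space by (auto simp: g'_def intro!: subspace_add subspace_scale)
  moreover have "\<forall>\<nu>. \<nu> \<notin> insert \<mu> F \<longrightarrow> g' \<nu> = 0" using F(4) by (auto simp: g'_def)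
  ultimately show ?case
    using F(1,2) \<mu>(1) by (intro exI[of _ "insert \<mu> F"] exI[of _ g']) auto
qed

lemma weight_space_trivial:
  assumes "span (\<Union>\<mu>\<in>I. weight_space smul act \<mu>) = UNIV" "\<nu> \<notin> I" "u \<in> weight_space smul act \<nu>"
  shows "u = 0"
proof -
  obtain F g where F: "finite F" "F \<subseteq> I" "\<forall>\<mu>. g \<mu> \<in> weight_space smul act \<mu>" "u = sum g F"
    using span_weight_spaces[of u I] assms(1) by auto
  define g' where "g' \<mu> = (if \<mu> = \<nu> then - u else g \<mu>)" for \<mu>
  have "\<nu> \<notin> F" using F(2) assms(2) by auto
  then have "sum g' (insert \<nu> F) = - u + sum g F"
    using F(1) by (simp add: g'_def cong: sum.cong_simp) (intro sum.cong, auto)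
  then have "\<forall>\<mu>\<in>insert \<nu> F. g' \<mu> = 0"
    using F assms(3) subspace_weight_space subspace_neg
    by (intro weight_vectors_independent) (auto simp: g'_def)
  then show ?thesis by (simp add: g'_def)
qed

text \<open>The weights of an integrable module are symmetric under reflections. Descending the
  \<open>f\<close>-string from a nonzero vector with \<open>h\<close>-eigenvalue \<open>-p\<close> ends in a vector \<open>w = f\<^sup>k u\<close> killed
  by \<open>f\<close>, with \<open>h\<close>-eigenvalue \<open>-r\<close> where \<open>r = p + 2k\<close>, and \<open>f e\<^bsup>i+1\<^esup> w = (i+1)(r-i) e\<^sup>i w\<close> shows that
  \<open>e\<^sup>i w \<noteq> 0\<close> for \<open>i \<le> r\<close>. The reflected weight is that of \<open>e\<^bsup>k+p\<^esup> w\<close>.\<close>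

lemma weight_reflection:
  assumes u: "u \<in> weight_space smul act \<mu>" "u \<noteq> 0"
    and nil: "\<exists>n. (act (chev_f j) ^^ n) u = 0"
    and p: "(if j = 0 then \<mu> $ 1 else \<mu> $ 2) = - of_nat p"
  shows "\<exists>w. w \<in> weight_space smul act (\<mu> + of_nat p *s simple_root j) \<and> w \<noteq> 0"
proof -
  define f where "f = act (chev_f j)"
  define e where "e = act (chev_e j)"
  define n where "n = (LEAST n. (f ^^ n) u = 0)"
  have n: "(f ^^ n) u = 0"
    unfolding n_def by (rule LeastI_ex) (use nil in \<open>simp add: f_def\<close>)
  have "n \<noteq> 0" using n u(2) by (metis funpow_0)
  then obtain k where k: "n = Suc k" by (cases n) auto
  define w where "w = (f ^^ k) u"
  have w: "w \<noteq> 0" "f w = 0"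
    using n not_less_Least[of k "\<lambda>n. (f ^^ n) u = 0"] unfolding n_def[symmetric] w_def k by auto
  have "(f ^^ i) u \<in> weight_space smul act (\<mu> - of_nat i *s simple_root j)" for i
  proof (induction i)
    case (Suc i)
    show ?case using chev_f_weight[OF Suc, of j]
      by (simp add: f_def algebra_simps vector_sadd_rdistrib)
  qed (use u in simp)
  then have "w \<in> weight_space smul act (\<mu> - of_nat k *s simple_root j)" by (simp add: w_def)
  then have ew: "(e ^^ i) w \<in> weight_space smul act (\<mu> + (of_nat i - of_nat k) *s simple_root j)" for i
  proof (induction i)
    case (Suc i)
    show ?case using chev_e_weight[OF Suc.IH[OF Suc.prems], of j]
      by (simp add: e_def algebra_simps vector_sadd_rdistrib vec_eq_iff vector_ssub_ldistrib)
  qed (simp add: vec_eq_iff weight_space_iff)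
  define r where "r = p + 2 * k"
  have h: "act (chev_h j) ((e ^^ i) w) = smul (2 * of_nat i - of_nat r) ((e ^^ i) w)" for i
    using chev_h_weight[OF ew[of i], of j] p
    by (cases "j = 0") (simp_all add: simple_root_entries r_def algebra_simps)
  have ef: "f (e x) = e (f x) - act (chev_h j) x" for x
    using act_commute[of "chev_e j" "chev_f j" x] by (simp add: bracket_chev_e_f e_def f_def)
  have fe: "f ((e ^^ Suc i) w) = smul (of_nat (Suc i) * (of_nat r - of_nat i)) ((e ^^ i) w)" for i
  proof (induction i)
    case 0
    show ?case using ef[of w] h[of 0] w(2) by (simp add: e_def)
  next
    case (Suc i)
    have "f ((e ^^ Suc (Suc i)) w) = e (f ((e ^^ Suc i) w)) - act (chev_h j) ((e ^^ Suc i) w)"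
      using ef[of "(e ^^ Suc i) w"] by simp
    also have "\<dots> = smul (of_nat (Suc i) * (of_nat r - of_nat i) - (2 * of_nat (Suc i) - of_nat r))
        ((e ^^ Suc i) w)"
      unfolding Suc h scale_left_diff_distrib by (simp add: e_def)
    also have "of_nat (Suc i) * (of_nat r - of_nat i) - (2 * of_nat (Suc i) - of_nat r)
        = of_nat (Suc (Suc i)) * (of_nat r - of_nat (Suc i) :: complex)"
      by (simp add: algebra_simps)
    finally show ?case .
  qed
  have ne: "(e ^^ i) w \<noteq> 0" if "i \<le> r" for i
    using that
  proof (induction i)
    case (Suc i)
    have "(of_nat r - of_nat i :: complex) \<noteq> 0" using Suc.prems by simp
    then have "f ((e ^^ Suc i) w) \<noteq> 0"
      unfolding fe using Suc by (simp del: of_nat_Suc)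
    then show ?case by (auto simp: f_def)
  qed (use w in simp)
  show ?thesis
    using ew[of "k + p"] ne[of "k + p"] by (auto simp: r_def)
qed

end

section \<open>Weights of the highest weight module\<close>

definition weight_below :: "weight \<Rightarrow> int \<Rightarrow> int \<Rightarrow> weight" where
  "weight_below lam m n = lam - of_int m *s simple_root 0 - of_int n *s simple_root 1"

lemma weight_below_entries:
  "weight_below lam m n $ 1 = lam $ 1 - 2 * of_int (m - n)"
  "weight_below lam m n $ 2 = lam $ 2 + 2 * of_int (m - n)"
  "weight_below lam m n $ 3 = lam $ 3 - of_int m"
  by (simp_all add: weight_below_def simple_root_entries algebra_simps)

lemma weight_below_eq_iff: "weight_below lam m n = weight_below lam m' n' \<longleftrightarrow> m = m' \<and> n = n'"
proof
  assume eq: "weight_below lam m n = weight_below lam m' n'"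
  have "weight_below lam m n $ 3 = weight_below lam m' n' $ 3"
    "weight_below lam m n $ 1 = weight_below lam m' n' $ 1"
    by (simp_all add: eq)
  then show "m = m' \<and> n = n'" by (simp add: weight_below_entries)
qed simp

lemma weight_below_shift:
  "weight_below lam m k + (of_int n *s null_root + simple_root 1) = weight_below lam (m - n) (k - n - 1)"
  "weight_below lam m k + (of_int n *s null_root - simple_root 1) = weight_below lam (m - n) (k - n + 1)"
  "weight_below lam m k + of_int n *s null_root = weight_below lam (m - n) (k - n)"
  "weight_below lam m k - simple_root j =
     weight_below lam (if j = 0 then m + 1 else m) (if j = 0 then k else k + 1)"
  "weight_below lam m k + simple_root j =
     weight_below lam (if j = 0 then m - 1 else m) (if j = 0 then k else k - 1)"
  by (simp_all add: vec_eq_iff forall_3 weight_below_entries null_root_entries simple_root_entries)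

context integrable_irreducible_hw_module
begin

definition hw_vector :: 'v where
  "hw_vector = (SOME v. v \<noteq> 0 \<and> v \<in> weight_space smul act lam \<and>
     (\<forall>j\<in>{0, 1}. act (chev_e j) v = 0) \<and> (\<forall>S. submodule S \<and> v \<in> S \<longrightarrow> S = UNIV))"

lemma hw_vector:
  "hw_vector \<noteq> 0" "hw_vector \<in> weight_space smul act lam" "act (chev_e j) hw_vector = 0"
  "submodule S \<Longrightarrow> hw_vector \<in> S \<Longrightarrow> S = UNIV"
proof -
  have *: "hw_vector \<noteq> 0 \<and> hw_vector \<in> weight_space smul act lam \<and>
     (\<forall>j\<in>{0, 1}. act (chev_e j) hw_vector = 0) \<and> (\<forall>S. submodule S \<and> hw_vector \<in> S \<longrightarrow> S = UNIV)"
    unfolding hw_vector_def using highest_weight unfolding highest_weight_module_def by (rule someI_ex)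
  then show "hw_vector \<noteq> 0" "hw_vector \<in> weight_space smul act lam"
    "submodule S \<Longrightarrow> hw_vector \<in> S \<Longrightarrow> S = UNIV" by blast+
  have "chev_e j = chev_e 0 \<or> chev_e j = chev_e 1" by (simp add: chev_e_def)
  with * show "act (chev_e j) hw_vector = 0" by auto
qed

definition f_monomial :: "nat list \<Rightarrow> 'v" where
  "f_monomial js = foldr (\<lambda>j. act (chev_f j)) js hw_vector"

lemma f_monomial_simps [simp]:
  "f_monomial [] = hw_vector" "f_monomial (j # js) = act (chev_f j) (f_monomial js)"
  by (simp_all add: f_monomial_def)

lemma f_monomial_weight:
  "\<exists>m n :: nat. f_monomial js \<in> weight_space smul act (weight_below lam (int m) (int n))"
proof (induction js)
  case Nil
  have "weight_below lam 0 0 = lam" by (simp add: weight_below_def)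
  then show ?case
    using hw_vector(2) by (intro exI[of _ 0]) simp
next
  case (Cons j js)
  then obtain m n where "f_monomial js \<in> weight_space smul act (weight_below lam (int m) (int n))"
    by auto
  from chev_f_weight[OF this, of j] show ?case
    unfolding weight_below_shift
    by (intro exI[of _ "if j = 0 then m + 1 else m"] exI[of _ "if j = 0 then n else n + 1"])
      (auto simp: add.commute)
qed

text \<open>The span of the monomials \<open>f\<^sub>j \<dots> f\<^sub>k v\<close> is stable under \<open>e\<^sub>i\<close>, since \<open>e\<^sub>i\<close> can be moved
  to the right until it kills the highest weight vector \<open>v\<close>; hence it is a submodule.\<close>

lemma span_f_monomial: "span (range f_monomial) = UNIV"
proof (rule hw_vector(4))
  let ?S = "span (range f_monomial)"
  have stable: "act x u \<in> ?S" if "\<And>js. act x (f_monomial js) \<in> ?S" "u \<in> ?S" for x u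
    using that(2)
    by (induction rule: span_induct_alt)
      (auto intro!: span_add span_scale that(1) span_zero)
  have h: "act (chev_h j) (f_monomial js) \<in> ?S" "act degree_d (f_monomial js) \<in> ?S" for j js
  proof -
    obtain \<mu> where "f_monomial js \<in> weight_space smul act \<mu>"
      using f_monomial_weight by blast
    then show "act (chev_h j) (f_monomial js) \<in> ?S" "act degree_d (f_monomial js) \<in> ?S"
      using chev_h_weight[of "f_monomial js" \<mu> j]
      by (simp_all add: weight_space_iff span_scale span_base)
  qed
  have f: "act (chev_f j) (f_monomial js) \<in> ?S" for j js
    by (metis f_monomial_simps(2) rangeI span_base)
  have e: "act (chev_e i) (f_monomial js) \<in> ?S" for i js
  proof (induction js)
    case (Cons j js)
    have "act (chev_f j) (act (chev_e i) (f_monomial js)) \<in> ?S"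
      using f Cons by (rule stable)
    moreover have "act (affine_bracket (chev_e i) (chev_f j)) (f_monomial js) \<in> ?S"
      unfolding bracket_chev_e_f using h by (auto intro: span_zero)
    ultimately show ?case
      by (simp add: act_commute[of "chev_e i" "chev_f j"] span_add)
  qed (simp add: hw_vector span_zero)
  show "submodule ?S"
    by (rule submoduleI) (auto intro: stable e f h)
  show "hw_vector \<in> ?S"
    by (metis f_monomial_simps(1) rangeI span_base)
qed

lemma hw_induct:
  assumes "subspace G" "hw_vector \<in> G" "\<And>j u. u \<in> G \<Longrightarrow> act (chev_f j) u \<in> G"
  shows "u \<in> G"
proof -
  have "f_monomial js \<in> G" for js
    by (induction js) (use assms in auto)
  then have "span (range f_monomial) \<subseteq> G"
    using assms(1) by (intro span_minimal) auto
  then show ?thesis using span_f_monomial by blast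
qed

abbreviation wt :: "int \<Rightarrow> int \<Rightarrow> 'v set" where
  "wt m n \<equiv> weight_space smul act (weight_below lam m n)"

lemma span_wt: "span (\<Union>(m, n)\<in>{0..} \<times> {0..}. wt m n) = UNIV"
proof -
  have "range f_monomial \<subseteq> (\<Union>(m, n)\<in>{0..} \<times> {0..}. wt m n)"
  proof clarify
    fix js
    from f_monomial_weight[of js] obtain m n :: nat where "f_monomial js \<in> wt (int m) (int n)"
      by auto
    then show "f_monomial js \<in> (\<Union>(m, n)\<in>{0..} \<times> {0..}. wt m n)"
      by (intro UN_I[of "(int m, int n)"]) auto
  qed
  from span_mono[OF this] show ?thesis by (auto simp: span_f_monomial)
qed

lemma weight_space_support:
  assumes "u \<in> weight_space smul act \<nu>" "u \<noteq> 0"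
  shows "\<exists>m n :: nat. \<nu> = weight_below lam (int m) (int n)"
proof (rule ccontr)
  assume *: "\<not> ?thesis"
  let ?I = "(\<lambda>(m, n). weight_below lam m n) ` ({0..} \<times> {0..})"
  have "\<nu> \<notin> ?I"
    using * by (auto simp: image_iff) (metis zero_le_imp_eq_int)
  moreover have "span (\<Union>\<mu>\<in>?I. weight_space smul act \<mu>) = UNIV"
    using span_wt by (simp add: image_image case_prod_unfold)
  ultimately show False
    using weight_space_trivial assms by blast
qed

lemma wt_trivial: "u \<in> wt m n \<Longrightarrow> m < 0 \<or> n < 0 \<Longrightarrow> u = 0"
  using weight_space_support[of u "weight_below lam m n"]
  by (cases "u = 0") (auto simp: weight_below_eq_iff)

lemma central_act: "act central u = smul (lam $ 1 + lam $ 2) u"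
proof -
  have c: "central = chev_h 0 + chev_h 1" by (simp add: chev_h_def)
  have "u \<in> {u. act central u = smul (lam $ 1 + lam $ 2) u}"
  proof (rule hw_induct)
    show "subspace {u. act central u = smul (lam $ 1 + lam $ 2) u}"
      by (auto simp: subspace_def scale_right_distrib mult.commute)
    show "hw_vector \<in> {u. act central u = smul (lam $ 1 + lam $ 2) u}"
      using hw_vector(2) by (simp add: c weight_space_iff scale_left_distrib)
  qed (simp add: central_commute)
  then show ?thesis by simp
qed

lemma locally_nilpotent:
  "\<exists>N\<ge>1. \<forall>n\<ge>N. opE n u = 0 \<and> opF n u = 0 \<and> opH n u = 0"
proof -
  let ?G = "{u. \<exists>N\<ge>1. \<forall>n\<ge>N. opE n u = 0 \<and> opF n u = 0 \<and> opH n u = 0}"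
  have "subspace ?G"
    unfolding subspace_def
  proof (intro conjI ballI allI)
    fix u w assume "u \<in> ?G" "w \<in> ?G"
    then obtain N N' where
      "N \<ge> 1" "\<forall>n\<ge>N. opE n u = 0 \<and> opF n u = 0 \<and> opH n u = 0"
      "N' \<ge> 1" "\<forall>n\<ge>N'. opE n w = 0 \<and> opF n w = 0 \<and> opH n w = 0" by blast
    then show "u + w \<in> ?G"
      by (intro CollectI exI[of _ "max N N'"]) auto
  qed (auto intro: exI[of _ 1])
  moreover have "wt m k \<subseteq> ?G" if "m \<ge> 0" for m k
  proof
    fix u assume u: "u \<in> wt m k"
    have "opE n u = 0 \<and> opF n u = 0 \<and> opH n u = 0" if "n \<ge> m + 1" for n
      using that opE_weight[OF u, of n] opF_weight[OF u, of n] opH_weight[OF u, of n] wt_trivial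
      unfolding weight_below_shift by (meson diff_less_0_iff_less less_add_one order_less_le_trans)
    then show "u \<in> ?G" using \<open>m \<ge> 0\<close> by (intro CollectI exI[of _ "m + 1"]) auto
  qed
  ultimately have "span (\<Union>(m, n)\<in>{0..} \<times> {0..}. wt m n) \<subseteq> ?G"
    by (intro span_minimal) auto
  then have "u \<in> ?G" unfolding span_wt by auto
  then show ?thesis by simp
qed

text \<open>The left-hand side is half of \<open>|\<lambda>|\<^sup>2 - |\<nu>|\<^sup>2\<close>, where
  \<open>\<nu> = \<lambda> - m \<alpha>\<^sub>0 - n \<alpha>\<^sub>1\<close>, and is therefore preserved by the Weyl group. If \<open>\<nu>\<close> is not dominant, then a
  simple reflection sends it to a weight of smaller depth; if it is, then the inequality follows
  from \<open>|\<lambda>|\<^sup>2 - |\<nu>|\<^sup>2 = (\<lambda> + \<nu>, \<lambda> - \<nu>)\<close>.\<close>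

lemma weights_in_paraboloid:
  fixes l0 l1 :: nat
  assumes lam: "lam $ 1 = of_nat l0" "lam $ 2 = of_nat l1"
    and u: "u \<in> wt m n" "u \<noteq> 0"
  shows "int l0 * m + int l1 * n - (m - n)\<^sup>2 \<ge> 0"
  using u
proof (induction "nat (m + n)" arbitrary: m n u rule: less_induct)
  case less
  have mn: "m \<ge> 0" "n \<ge> 0" using wt_trivial less.prems by force+
  define d where "d = m - n"
  have nil: "\<exists>k. (act (chev_f j) ^^ k) u = 0" if "j \<in> {0, 1}" for j u
    using integrable that unfolding integrable_def by blast
  consider (dom) "int l0 - 2 * d \<ge> 0" "int l1 + 2 * d \<ge> 0" | (r0) "int l0 - 2 * d < 0"
    | (r1) "int l1 + 2 * d < 0" by linarith
  then show ?case
  proof cases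
    case dom
    have "0 \<le> m * (int l0 + (int l0 - 2 * d))"
      by (rule mult_nonneg_nonneg) (use dom mn in linarith)+
    moreover have "0 \<le> n * (int l1 + (int l1 + 2 * d))"
      by (rule mult_nonneg_nonneg) (use dom mn in linarith)+
    ultimately show ?thesis
      by (simp add: d_def algebra_simps power2_eq_square)
  next
    case r0
    define p where "p = nat (2 * d - int l0)"
    have p: "int p = 2 * d - int l0" "p > 0" using r0 by (simp_all add: p_def)
    have "(of_nat p :: complex) = of_int (2 * d - int l0)" using p by (metis of_int_of_nat_eq)
    then have "weight_below lam m n $ 1 = - of_nat p"
      by (simp add: weight_below_entries lam d_def)
    then obtain w where w: "w \<in> weight_space smul act (weight_below lam m n + of_nat p *s simple_root 0)"
      "w \<noteq> 0"
      using weight_reflection[OF less.prems, of 0 p] nil[of 0] by auto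
    have "weight_below lam m n + of_nat p *s simple_root 0 = weight_below lam (m - int p) n"
      by (simp add: vec_eq_iff forall_3 weight_below_entries simple_root_entries)
    with w have w: "w \<in> wt (m - int p) n" by simp
    then have "m - int p \<ge> 0" using wt_trivial \<open>w \<noteq> 0\<close> by force
    then have "0 \<le> int l0 * (m - int p) + int l1 * n - (m - int p - n)\<^sup>2"
      using p mn by (intro less.hyps[OF _ w \<open>w \<noteq> 0\<close>]) auto
    then show ?thesis
      unfolding p(1) d_def by (simp add: algebra_simps power2_eq_square)
  next
    case r1
    define p where "p = nat (- 2 * d - int l1)"
    have p: "int p = - 2 * d - int l1" "p > 0" using r1 by (simp_all add: p_def)
    have "(of_nat p :: complex) = of_int (- 2 * d - int l1)" using p by (metis of_int_of_nat_eq)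
    then have "weight_below lam m n $ 2 = - of_nat p"
      by (simp add: weight_below_entries lam d_def)
    then obtain w where w: "w \<in> weight_space smul act (weight_below lam m n + of_nat p *s simple_root 1)"
      "w \<noteq> 0"
      using weight_reflection[OF less.prems, of 1 p] nil[of 1] by auto
    have "weight_below lam m n + of_nat p *s simple_root 1 = weight_below lam m (n - int p)"
      by (simp add: vec_eq_iff forall_3 weight_below_entries simple_root_entries)
    with w have w: "w \<in> wt m (n - int p)" by simp
    then have "n - int p \<ge> 0" using wt_trivial \<open>w \<noteq> 0\<close> by force
    then have "0 \<le> int l0 * m + int l1 * (n - int p) - (m - (n - int p))\<^sup>2"
      using p mn by (intro less.hyps[OF _ w \<open>w \<noteq> 0\<close>]) auto
    then show ?thesis
      unfolding p(1) d_def by (simp add: algebra_simps power2_eq_square)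
  qed
qed

end

section \<open>The Casimir operator\<close>

context integrable_irreducible_hw_module
begin

abbreviation level :: complex where "level \<equiv> lam $ 1 + lam $ 2"

definition casimir_mode :: "int \<Rightarrow> 'v \<Rightarrow> 'v" where
  "casimir_mode n u = smul 2 (opE (- n) (opF n u)) + smul 2 (opF (- n) (opE n u)) + opH (- n) (opH n u)"

text \<open>Twice the Casimir operator, which avoids the fraction in the dual bases \<open>e, f, h\<close> and
  \<open>f, e, h/2\<close>, truncated to the modes up to \<open>M\<close>. On each vector the truncations agree from some \<open>M\<close>
  on, because positive modes act locally nilpotently.\<close>

definition casimir :: "nat \<Rightarrow> 'v \<Rightarrow> 'v" where
  "casimir M u = casimir_mode 0 u + smul 2 (\<Sum>n=1..M. casimir_mode (int n) u)
     + smul (4 * (level + 2)) (act degree_d u)"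

text \<open>The commutator of \<open>f\<^sub>0 = t\<^bsup>-1\<^esup> \<otimes> e\<close> with the mode \<open>n \<ge> 1\<close> is a difference of two such operators, for
  \<open>n\<close> and \<open>n + 1\<close>, up to a central term. Summed over the modes, the differences telescope: the first
  operator and the central term are compensated by the mode \<open>0\<close> and by \<open>d\<close>, and the last operator
  vanishes on any given vector for large \<open>M\<close>.\<close>

definition mode_remainder :: "int \<Rightarrow> 'v \<Rightarrow> 'v" where
  "mode_remainder n u = smul 2 (opE (- n) (opH (n - 1) u)) - smul 2 (opH (- n) (opE (n - 1) u))"

lemmas smul_distribs =
  scale_right_distrib scale_right_diff_distrib scale_left_distrib scale_left_diff_distrib

lemma smul_four: "smul 4 u = u + u + u + u"
  using scale_left_distrib[of 2 2 u] by (simp add: smul_two add.assoc)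

lemma smul_eight: "smul 8 u = smul 4 u + smul 4 u"
  using scale_left_distrib[of 4 4 u] by simp

lemma casimir_mode_opF: "opF 0 (casimir_mode n u) = casimir_mode n (opF 0 u)"
proof -
  have FH: "opF 0 (opH k w) = opH k (opF 0 w) + smul 2 (opF k w)" for k w
    using opH_opF[of k 0 w] by simp
  have FE: "opF 0 (opE k w) = opE k (opF 0 w) - opH k w" for k w
    using opE_opF[of k 0 w] by (simp split: if_splits)
  have FF: "opF 0 (opF k w) = opF k (opF 0 w)" for k w
    by (rule opF_opF)
  show ?thesis
    unfolding casimir_mode_def
    by (simp add: FH FE FF[of "-n"] FF[of n] smul_two)
qed

lemma casimir_mode_opE:
  assumes "n \<ge> 1"
  shows "opE (- 1) (casimir_mode n u) = casimir_mode n (opE (- 1) u)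
    + mode_remainder n u - mode_remainder (n + 1) u
    - (if n = 1 then smul (2 * level) (opE (- 1) u) else 0)"
proof -
  define c where "c = (if n = 1 then smul level (opE (- 1) u) else 0)"
  have c: "(if n = 1 then smul (2 * level) (opE (- 1) u) else 0) = c + c"
    unfolding c_def mult_2 by (cases "n = 1") (simp_all only: scale_left_distrib refl if_True if_False add_0)
  have EF: "opE (- 1) (opE (- n) (opF n u)) = opE (- n) (opF n (opE (- 1) u)) + opE (- n) (opH (n - 1) u) - c"
    by (subst opE_opE) (auto simp: opE_opF[of "-1"] central_act smul_distribs c_def)
  have FE: "opE (- 1) (opF (- n) (opE n u)) = opF (- n) (opE n (opE (- 1) u)) + opH (- 1 - n) (opE n u)"
    using assms by (simp add: opE_opF[of "-1"] opE_opE[of "-1" n] add.commute)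
  have EH: "opE (- 1) (opH k w) = opH k (opE (- 1) w) - smul 2 (opE (k - 1) w)" for k w
    using opH_opE[of k "-1" w] by simp
  have n: "- n - 1 = - 1 - n" by simp
  show ?thesis
    unfolding casimir_mode_def mode_remainder_def c
    by (simp add: EF FE EH n smul_two algebra_simps del: minus_diff_commute)
qed

lemma casimir_mode_0_opE:
  "opE (- 1) (casimir_mode 0 u) = casimir_mode 0 (opE (- 1) u)
    - smul 2 (mode_remainder 1 u) - smul 8 (opE (- 1) u)"
proof -
  have EH: "opE l (opH k w) = opH k (opE l w) - smul 2 (opE (k + l) w)" for k l w
    using opH_opE[of k l w] by simp
  have EF: "opE (- 1) (opE 0 (opF 0 u))
      = opE 0 (opF 0 (opE (- 1) u)) + opH (- 1) (opE 0 u) - smul 2 (opE (- 1) u)"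
    by (subst opE_opE) (auto simp: opE_opF[of "-1"] EH)
  have FE: "opE (- 1) (opF 0 (opE 0 u)) = opF 0 (opE 0 (opE (- 1) u)) + opH (- 1) (opE 0 u)"
    by (simp add: opE_opF[of "-1"] opE_opE[of "-1" 0] add.commute)
  show ?thesis
    unfolding casimir_mode_def mode_remainder_def
    by (simp add: EF FE EH smul_two smul_four smul_eight algebra_simps)
qed

lemma casimir_opF: "casimir M (opF 0 u) = opF 0 (casimir M u)"
  by (simp add: casimir_def casimir_mode_opF d_loop)

lemma casimir_opE:
  "opE (- 1) (casimir M u) = casimir M (opE (- 1) u) - smul 2 (mode_remainder (int M + 1) u)"
  if "M \<ge> 1"
proof -
  have tail: "opE (- 1) (\<Sum>n=1..M. casimir_mode (int n) u)
      = (\<Sum>n=1..M. casimir_mode (int n) (opE (- 1) u))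
        + mode_remainder 1 u - mode_remainder (int M + 1) u - smul (2 * level) (opE (- 1) u)"
    using that
  proof (induction M rule: dec_induct)
    case (step M)
    have "opE (- 1) (casimir_mode (int (Suc M)) u) = casimir_mode (int (Suc M)) (opE (- 1) u)
        + mode_remainder (int M + 1) u - mode_remainder (int (Suc M) + 1) u"
      using step(1) by (subst casimir_mode_opE) (auto simp: add.commute)
    moreover have "opE (- 1) (\<Sum>n=1..Suc M. casimir_mode (int n) u)
        = opE (- 1) (\<Sum>n=1..M. casimir_mode (int n) u) + opE (- 1) (casimir_mode (int (Suc M)) u)"
      using step(1) by (simp del: act_hom(6))
    moreover have "(\<Sum>n=1..Suc M. casimir_mode (int n) (opE (- 1) u))
        = (\<Sum>n=1..M. casimir_mode (int n) (opE (- 1) u)) + casimir_mode (int (Suc M)) (opE (- 1) u)"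
      using step(1) by simp
    ultimately show ?case
      unfolding step(3) by (simp add: add.commute add.left_commute)
  qed (simp add: casimir_mode_opE)
  have "opE (- 1) (casimir M u) = casimir M (opE (- 1) u) - smul 2 (mode_remainder (int M + 1) u)
     + (- smul 8 (opE (- 1) u) - smul 2 (smul (2 * level) (opE (- 1) u))
        + smul (4 * (level + 2)) (opE (- 1) u))"
  proof -
    have rearrange: "(a - smul 2 b - e) + smul 2 (s + b - r - g) + smul k y
        = (a + smul 2 s + smul k (y + smul (of_int (- 1)) x)) - smul 2 r + (- e - smul 2 g + smul k x)"
      for a b e s r g x y k
      by (simp add: scale_right_distrib scale_right_diff_distrib)
    show ?thesis
      unfolding casimir_def act_hom(1,5) tail casimir_mode_0_opE d_loop by (rule rearrange)
  qed
  also have "- smul 8 (opE (- 1) u) - smul 2 (smul (2 * level) (opE (- 1) u))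
        + smul (4 * (level + 2)) (opE (- 1) u)
      = smul (- 8 - 2 * (2 * level) + 4 * (level + 2)) (opE (- 1) u)"
    by (simp only: scale_scale scale_left_diff_distrib scale_left_distrib scale_minus_left)
  also have "- 8 - 2 * (2 * level) + 4 * (level + 2) = 0"
    by (simp add: algebra_simps)
  finally show ?thesis by simp
qed

lemma casimir_mode_0: "casimir_mode 0 u = smul 4 (opF 0 (opE 0 u)) + smul 2 (opH 0 u) + opH 0 (opH 0 u)"
proof -
  have "opE 0 (opF 0 u) = opF 0 (opE 0 u) + opH 0 u" by (simp add: opE_opF)
  then show ?thesis
    by (simp add: casimir_mode_def smul_two smul_four add_ac)
qed

lemma opE_hw_vector: "n \<ge> 0 \<Longrightarrow> opE n hw_vector = 0"
  and opF_hw_vector: "n \<ge> 1 \<Longrightarrow> opF n hw_vector = 0"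
  and opH_hw_vector: "n \<ge> 1 \<Longrightarrow> opH n hw_vector = 0"
proof -
  have "lam = weight_below lam 0 0" by (simp add: weight_below_def)
  then have w: "hw_vector \<in> wt 0 0" using hw_vector(2) by simp
  show "n \<ge> 0 \<Longrightarrow> opE n hw_vector = 0" "n \<ge> 1 \<Longrightarrow> opF n hw_vector = 0" "n \<ge> 1 \<Longrightarrow> opH n hw_vector = 0"
    using opE_weight[OF w, of n] opF_weight[OF w, of n] opH_weight[OF w, of n]
    unfolding weight_below_shift by (auto dest: wt_trivial)
qed

text \<open>This is \<open>2 (|\<mu> + \<rho>|\<^sup>2 - |\<rho>|\<^sup>2)\<close> for weights \<open>\<mu>\<close> of the level of \<open>\<lambda>\<close>.\<close>

definition casimir_value :: "weight \<Rightarrow> complex" where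
  "casimir_value \<mu> = (\<mu> $ 2)\<^sup>2 + 2 * \<mu> $ 2 + 4 * (level + 2) * \<mu> $ 3"

lemma casimir_on_weight_vector:
  assumes "u \<in> weight_space smul act \<mu>"
  shows "casimir M u = smul (casimir_value \<mu>) u + smul 4 (opF 0 (opE 0 u))
    + smul 2 (\<Sum>n=1..M. casimir_mode (int n) u)"
proof -
  have H: "opH 0 u = smul (\<mu> $ 2) u" "act degree_d u = smul (\<mu> $ 3) u"
    using assms by (simp_all add: weight_space_iff chev_h_1)
  have scalar: "smul (x\<^sup>2 + 2 * x + c * y) u = smul 2 (smul x u) + smul x (smul x u) + smul c (smul y u)"
    for x y c
    by (simp add: scale_left_distrib power2_eq_square add_ac)
  show ?thesis
    unfolding casimir_def casimir_mode_0 casimir_value_def scalar act_hom H by (simp only: add_ac)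
qed

text \<open>The module is generated from the highest weight vector by \<open>f\<^sub>0\<close> and \<open>f\<^sub>1\<close>, so it is enough that
  the Casimir operator commutes with these two.\<close>

lemma casimir_scalar: "\<exists>M0. \<forall>M\<ge>M0. casimir M u = smul (casimir_value lam) u"
proof -
  let ?G = "{u. \<exists>M0. \<forall>M\<ge>M0. casimir M u = smul (casimir_value lam) u}"
  have "u \<in> ?G"
  proof (rule hw_induct)
    have add: "casimir M (u + w) = casimir M u + casimir M w" for M u w
      by (simp add: casimir_def casimir_mode_def smul_distribs sum.distrib algebra_simps)
    have sc: "casimir M (smul s u) = smul s (casimir M u)" for M u s
      by (simp add: casimir_def casimir_mode_def scale_right_distrib scale_sum_right mult.commute)
    show "subspace ?G"
      unfolding subspace_def
    proof (intro conjI ballI allI)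
      fix u w assume "u \<in> ?G" "w \<in> ?G"
      then obtain N N' where
        "\<forall>M\<ge>N. casimir M u = smul (casimir_value lam) u"
        "\<forall>M\<ge>N'. casimir M w = smul (casimir_value lam) w" by blast
      then show "u + w \<in> ?G"
        by (intro CollectI exI[of _ "max N N'"]) (auto simp: add scale_right_distrib)
    next
      show "0 \<in> ?G" using sc[of _ 0 0] by simp
    next
      fix c u assume "u \<in> ?G"
      then show "smul c u \<in> ?G" by (auto simp: sc mult.commute) (metis scale_scale mult.commute)
    qed
    have "casimir M hw_vector = smul (casimir_value lam) hw_vector" for M
      by (simp add: casimir_on_weight_vector[OF hw_vector(2)] opE_hw_vector casimir_mode_def
          opF_hw_vector opH_hw_vector)
    then show "hw_vector \<in> ?G" by simp
  next
    fix j u assume "u \<in> ?G"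
    then obtain M0 where M0: "\<And>M. M \<ge> M0 \<Longrightarrow> casimir M u = smul (casimir_value lam) u" by blast
    show "act (chev_f j) u \<in> ?G"
    proof (cases "j = 0")
      case True
      obtain N where N: "N \<ge> 1" "\<And>n. n \<ge> N \<Longrightarrow> opE n u = 0" "\<And>n. n \<ge> N \<Longrightarrow> opH n u = 0"
        using locally_nilpotent[of u] by blast
      have "casimir M (opE (- 1) u) = smul (casimir_value lam) (opE (- 1) u)"
        if "M \<ge> max M0 (nat N)" for M
      proof -
        have "mode_remainder (int M + 1) u = 0"
          using that N(2,3)[of "int M"] nat_le_iff[of N M] by (simp add: mode_remainder_def)
        then show ?thesis
          using casimir_opE[of M u] M0[of M] that N(1) nat_le_iff[of N M] by simp
      qed
      then have "opE (- 1) u \<in> ?G" by blast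
      then show ?thesis using True by (simp add: chev_f_def)
    next
      case False
      have "casimir M (opF 0 u) = smul (casimir_value lam) (opF 0 u)" if "M \<ge> M0" for M
        using M0[OF that] by (simp add: casimir_opF)
      then have "opF 0 u \<in> ?G" by blast
      then show ?thesis using False by (simp add: chev_f_def)
    qed
  qed
  then show ?thesis by simp
qed

text \<open>The Casimir operator acts on a vector of weight \<open>\<nu> = \<lambda> - m \<alpha>\<^sub>0 - k \<alpha>\<^sub>1\<close> by the same scalar as on the
  highest weight vector. The scalar on the left is \<open>2 (|\<lambda> + \<rho>|\<^sup>2 - |\<nu> + \<rho>|\<^sup>2)\<close>, and the right-hand side is the
  part of the operator that kills the highest weight vector.\<close>

lemma casimir_recursion:
  assumes u: "u \<in> wt m k"
  shows "\<exists>M. smul (4 * (lam $ 1 * of_int m + lam $ 2 * of_int k - (of_int (m - k))\<^sup>2 + of_int (m + k))) u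
     = smul 4 (opF 0 (opE 0 u)) + smul 2 (\<Sum>n=1..M. casimir_mode (int n) u)"
proof -
  from casimir_scalar[of u] obtain M0 where M0: "\<forall>M\<ge>M0. casimir M u = smul (casimir_value lam) u"
    by (rule exE)
  have M: "casimir M0 u = smul (casimir_value lam) u"
    using M0 by blast
  have eq: "casimir M0 u = smul (casimir_value (weight_below lam m k)) u + smul 4 (opF 0 (opE 0 u)) + smul 2 (\<Sum>n=1..M0. casimir_mode (int n) u)"
    by (rule casimir_on_weight_vector[OF u])
  have d: "smul (casimir_value lam) u - smul (casimir_value (weight_below lam m k)) u
      = smul 4 (opF 0 (opE 0 u)) + smul 2 (\<Sum>n=1..M0. casimir_mode (int n) u)"
    unfolding M[symmetric] eq by simp
  have v: "casimir_value lam - casimir_value (weight_below lam m k)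
      = 4 * (lam $ 1 * of_int m + lam $ 2 * of_int k - (of_int (m - k))\<^sup>2 + of_int (m + k))"
    by (simp add: casimir_value_def weight_below_entries algebra_simps power2_eq_square)
  show ?thesis
    using d unfolding scale_left_diff_distrib[symmetric] v by (rule exI)
qed

end

section \<open>Characters of the fixed subalgebra\<close>

text \<open>The fixed subalgebra contains \<open>e\<^sub>\<beta> - f\<^sub>\<beta>\<close> for all root vectors. A character vanishes on
  brackets, hence on the elements of imaginary roots, and takes only two values on those of real
  roots. In particular its values on these elements are bounded.\<close>

definition real_fixed :: "int \<Rightarrow> affine" where
  "real_fixed n = loop n sl2_e - loop (- n) sl2_f"

definition imag_fixed :: "int \<Rightarrow> affine" where
  "imag_fixed n = loop n sl2_h - loop (- n) sl2_h"

lemma chev_theta_loop: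
  "chev_theta (loop n sl2_e) = - loop (- n) sl2_f"
  "chev_theta (loop n sl2_f) = - loop (- n) sl2_e"
  "chev_theta (loop n sl2_h) = - loop (- n) sl2_h"
  by (rule affine_eqI; auto simp: chev_theta_components loop_def lookup_single when_def
      sl2_theta_def sl2_e_def sl2_f_def sl2_h_def vec_eq_iff forall_3)+

lemma real_fixed: "real_fixed n \<in> fixed_subalgebra"
  and imag_fixed: "imag_fixed n \<in> fixed_subalgebra"
proof -
  interpret Vector_Spaces.linear affine_scale affine_scale chev_theta
    by (rule chev_theta_linear)
  show "real_fixed n \<in> fixed_subalgebra" "imag_fixed n \<in> fixed_subalgebra"
    by (simp_all add: fixed_subalgebra_def real_fixed_def imag_fixed_def diff chev_theta_loop)
qed

lemma affine_bracket_diff: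
  "affine_bracket (x - y) z = affine_bracket x z - affine_bracket y z"
  "affine_bracket z (x - y) = affine_bracket z x - affine_bracket z y"
proof -
  interpret L: Vector_Spaces.linear affine_scale affine_scale "\<lambda>x. affine_bracket x z"
    by (rule affine_bracket_linear_left)
  show "affine_bracket (x - y) z = affine_bracket x z - affine_bracket y z" by (rule L.diff)
  then show "affine_bracket z (x - y) = affine_bracket z x - affine_bracket z y"
    using affine_bracket_antisym[of z] by simp
qed

lemma bracket_real_fixed: "affine_bracket (real_fixed 0) (real_fixed n) = imag_fixed n"
  by (simp add: real_fixed_def imag_fixed_def affine_bracket_diff bracket_loop_basis)

lemma bracket_imag_fixed: "affine_bracket (imag_fixed 1) (real_fixed n)
    = affine_scale 2 (real_fixed (n + 1) - real_fixed (n - 1))"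
  by (simp add: real_fixed_def imag_fixed_def affine_bracket_diff bracket_loop_basis
      affine.scale_right_diff_distrib add.commute minus_diff_commute)

context
  fixes chi assumes chi: "one_dim_rep chi"
begin

lemma chi_bracket: "x \<in> fixed_subalgebra \<Longrightarrow> y \<in> fixed_subalgebra \<Longrightarrow> chi (affine_bracket x y) = 0"
  using chi by (simp add: one_dim_rep_def)

lemma chi_imag_fixed: "chi (imag_fixed n) = 0"
  using chi_bracket[OF real_fixed[of 0] real_fixed[of n]] by (simp add: bracket_real_fixed)

lemma chi_real_fixed_step: "chi (real_fixed (n + 1)) = chi (real_fixed (n - 1))"
proof -
  interpret T: Vector_Spaces.linear affine_scale affine_scale chev_theta
    by (rule chev_theta_linear)
  have diff: "real_fixed (n + 1) - real_fixed (n - 1) \<in> fixed_subalgebra"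
    using real_fixed by (simp add: fixed_subalgebra_def T.diff)
  have "2 * chi (real_fixed (n + 1) - real_fixed (n - 1)) = 0"
    using chi_bracket[OF imag_fixed[of 1] real_fixed[of n]] chi diff
    by (simp add: bracket_imag_fixed one_dim_rep_def)
  moreover have "chi (real_fixed (n + 1))
     = chi ((real_fixed (n + 1) - real_fixed (n - 1)) + real_fixed (n - 1))" by simp
  moreover have "\<dots> = chi (real_fixed (n + 1) - real_fixed (n - 1)) + chi (real_fixed (n - 1))"
    using chi diff real_fixed unfolding one_dim_rep_def by blast
  ultimately show ?thesis by simp
qed

lemma chi_real_fixed_cases: "chi (real_fixed n) \<in> {chi (real_fixed 0), chi (real_fixed 1)}"
proof -
  have p: "chi (real_fixed (int k)) \<in> {chi (real_fixed 0), chi (real_fixed 1)}" for k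
  proof (induction k rule: less_induct)
    case (less k)
    then show ?case
      using chi_real_fixed_step[of "int k - 1"] less[of "k - 2"]
      by (cases "k < 2") (auto simp: less_2_cases_iff of_nat_diff)
  qed
  have m: "chi (real_fixed (- int k)) \<in> {chi (real_fixed 0), chi (real_fixed 1)}" for k
  proof (induction k rule: less_induct)
    case (less k)
    consider "k = 0" | "k = 1" | "k \<ge> 2" by linarith
    then show ?case
    proof cases
      case 3
      then show ?thesis
        using chi_real_fixed_step[of "- int k + 1"] less[of "k - 2"]
        by (auto simp: of_nat_diff)
    qed (use chi_real_fixed_step[of 0] in auto)
  qed
  show ?thesis using p[of "nat n"] m[of "nat (- n)"] by (cases "n \<ge> 0") auto
qed

end

section \<open>Sphericity relations for root vectors\<close>

lemma root_component_diff: "root_component \<beta> (x - y) = root_component \<beta> x - root_component \<beta> y"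
  by (rule affine_eqI) (auto simp: root_component_components lookup_minus vec_eq_iff forall_3)

lemma root_component_loop:
  "root_component \<beta> (loop n sl2_e) = (if \<beta> = of_int n *s null_root + simple_root 1 then loop n sl2_e else 0)"
  "root_component \<beta> (loop n sl2_f) = (if \<beta> = of_int n *s null_root - simple_root 1 then loop n sl2_f else 0)"
  "root_component \<beta> (loop n sl2_h) = (if \<beta> = of_int n *s null_root then loop n sl2_h else 0)"
  by (rule affine_eqI; auto simp: root_component_components loop_def lookup_single when_def
      sl2_e_def sl2_f_def sl2_h_def vec_eq_iff[of "vector _"] forall_3)+

context affine_module
begin

lemma completion_act_two_roots:
  assumes "\<And>\<gamma>. root_component \<gamma> x = (if \<gamma> = \<beta> then y else 0) - (if \<gamma> = - \<beta> then z else 0)" "\<beta> \<noteq> - \<beta>"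
  shows "completion_act act x v \<mu> = act y (v (\<mu> - \<beta>)) - act z (v (\<mu> + \<beta>))"
proof -
  have "completion_act act x v \<mu> = (\<Sum>\<gamma>\<in>{\<beta>, - \<beta>}. act (root_component \<gamma> x) (v (\<mu> - \<gamma>)))"
    unfolding completion_act_def by (rule Sum_any.expand_superset) (auto simp: assms)
  also have "\<dots> = act y (v (\<mu> - \<beta>)) - act z (v (\<mu> + \<beta>))"
    using assms(2) by (simp add: assms(1) equation_minus_iff[symmetric])
  finally show ?thesis .
qed

lemma dual_completion_act_two_roots:
  assumes "\<And>\<gamma>. root_component \<gamma> x = (if \<gamma> = \<beta> then y else 0) - (if \<gamma> = - \<beta> then z else 0)" "\<beta> \<noteq> - \<beta>"
    and f: "\<And>\<mu>. f \<mu> 0 = 0"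
  shows "dual_completion_act act f x \<mu> u = f (\<mu> + \<beta>) (act y u) + f (\<mu> - \<beta>) (- act z u)"
proof -
  have "dual_completion_act act f x \<mu> u = (\<Sum>\<gamma>\<in>{\<beta>, - \<beta>}. f (\<mu> + \<gamma>) (act (root_component \<gamma> x) u))"
    unfolding dual_completion_act_def by (rule Sum_any.expand_superset) (auto simp: assms(1) f)
  also have "\<dots> = f (\<mu> + \<beta>) (act y u) + f (\<mu> - \<beta>) (- act z u)"
    using assms(2) by (simp add: assms(1) equation_minus_iff[symmetric])
  finally show ?thesis .
qed

lemma dual_space_hom:
  assumes "f \<in> dual_space smul W" "subspace W"
  shows "f 0 = 0" "u \<in> W \<Longrightarrow> f (smul s u) = s * f u" "u \<in> W \<Longrightarrow> f (- u) = - f u"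
    "u \<in> W \<Longrightarrow> w \<in> W \<Longrightarrow> f (u + w) = f u + f w" "u \<in> W \<Longrightarrow> w \<in> W \<Longrightarrow> f (u - w) = f u - f w"
    "(\<And>i. i \<in> A \<Longrightarrow> g i \<in> W) \<Longrightarrow> f (sum g A) = (\<Sum>i\<in>A. f (g i))"
proof -
  show add: "u \<in> W \<Longrightarrow> w \<in> W \<Longrightarrow> f (u + w) = f u + f w" for u w
    using assms by (simp add: dual_space_def)
  show scale: "u \<in> W \<Longrightarrow> f (smul s u) = s * f u" for s u
    using assms by (simp add: dual_space_def)
  show zero: "f 0 = 0"
    using scale[OF subspace_0[OF assms(2)], of 0] by simp
  show neg: "u \<in> W \<Longrightarrow> f (- u) = - f u" for u
    using scale[of u "- 1"] by simp
  show "u \<in> W \<Longrightarrow> w \<in> W \<Longrightarrow> f (u - w) = f u - f w"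
    using add[of u "- w"] neg[of w] subspace_neg[OF assms(2)] by simp
  show "(\<And>i. i \<in> A \<Longrightarrow> g i \<in> W) \<Longrightarrow> f (sum g A) = (\<Sum>i\<in>A. f (g i))"
    by (induction A rule: infinite_finite_induct)
      (auto simp: zero add subspace_sum[OF assms(2)])
qed

lemma completion_spherical_relations:
  assumes "one_dim_rep chi" and v: "v \<in> completion_spherical smul act chi"
  shows "opE n (v (\<mu> - (of_int n *s null_root + simple_root 1)))
      - opF (- n) (v (\<mu> + (of_int n *s null_root + simple_root 1))) = smul (chi (real_fixed n)) (v \<mu>)"
    and "n \<noteq> 0 \<Longrightarrow> opH n (v (\<mu> - of_int n *s null_root)) = opH (- n) (v (\<mu> + of_int n *s null_root))"
proof -
  have s: "completion_act act x v \<mu> = smul (chi x) (v \<mu>)" if "x \<in> fixed_subalgebra" for x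
    using v that by (simp add: completion_spherical_def)
  show "opE n (v (\<mu> - (of_int n *s null_root + simple_root 1)))
      - opF (- n) (v (\<mu> + (of_int n *s null_root + simple_root 1))) = smul (chi (real_fixed n)) (v \<mu>)"
    unfolding s[OF real_fixed, symmetric]
    by (rule completion_act_two_roots[symmetric])
      (auto simp: real_fixed_def root_component_diff root_component_loop vec_eq_iff forall_3
        null_root_entries simple_root_entries)
  assume n: "n \<noteq> 0"
  have "completion_act act (imag_fixed n) v \<mu> =
     opH n (v (\<mu> - of_int n *s null_root)) - opH (- n) (v (\<mu> + of_int n *s null_root))"
    by (rule completion_act_two_roots)
      (use n in \<open>auto simp: imag_fixed_def root_component_diff root_component_loop vec_eq_iff forall_3
        null_root_entries simple_root_entries\<close>)
  then show "opH n (v (\<mu> - of_int n *s null_root)) = opH (- n) (v (\<mu> + of_int n *s null_root))"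
    using s[OF imag_fixed[of n]] by (simp add: chi_imag_fixed[OF assms(1)])
qed

lemma dual_completion_spherical_relations:
  assumes "one_dim_rep chi" and f: "f \<in> dual_completion_spherical smul act chi"
    and u: "u \<in> weight_space smul act \<mu>"
  shows "f (\<mu> + (of_int n *s null_root + simple_root 1)) (opE n u)
      - f (\<mu> - (of_int n *s null_root + simple_root 1)) (opF (- n) u) = chi (real_fixed n) * f \<mu> u"
    and "n \<noteq> 0 \<Longrightarrow> f (\<mu> + of_int n *s null_root) (opH n u) = f (\<mu> - of_int n *s null_root) (opH (- n) u)"
proof -
  have dual: "f \<nu> \<in> dual_space smul (weight_space smul act \<nu>)" for \<nu>
    using f by (auto simp: dual_completion_spherical_def dual_completion_def)
  note hom = dual_space_hom[OF dual subspace_weight_space]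
  have s: "dual_completion_act act f x \<mu> u = chi x * f \<mu> u" if "x \<in> fixed_subalgebra" for x
    using f u that by (simp add: dual_completion_spherical_def)
  have "opF (- n) u \<in> weight_space smul act (\<mu> - (of_int n *s null_root + simple_root 1))"
    using opF_weight[OF u, of "-n"] by (simp add: algebra_simps)
  then have "f (\<mu> - (of_int n *s null_root + simple_root 1)) (- opF (- n) u)
    = - f (\<mu> - (of_int n *s null_root + simple_root 1)) (opF (- n) u)"
    by (rule hom)
  moreover have "dual_completion_act act f (real_fixed n) \<mu> u =
     f (\<mu> + (of_int n *s null_root + simple_root 1)) (opE n u)
      + f (\<mu> - (of_int n *s null_root + simple_root 1)) (- opF (- n) u)"
    by (rule dual_completion_act_two_roots)
      (auto simp: real_fixed_def root_component_diff root_component_loop vec_eq_iff forall_3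
        null_root_entries simple_root_entries hom(1))
  ultimately show "f (\<mu> + (of_int n *s null_root + simple_root 1)) (opE n u)
      - f (\<mu> - (of_int n *s null_root + simple_root 1)) (opF (- n) u) = chi (real_fixed n) * f \<mu> u"
    using s[OF real_fixed[of n]] by simp
  assume n: "n \<noteq> 0"
  have "opH (- n) u \<in> weight_space smul act (\<mu> - of_int n *s null_root)"
    using opH_weight[OF u, of "-n"] by simp
  then have "f (\<mu> - of_int n *s null_root) (- opH (- n) u)
    = - f (\<mu> - of_int n *s null_root) (opH (- n) u)"
    by (rule hom)
  moreover have "dual_completion_act act f (imag_fixed n) \<mu> u =
     f (\<mu> + of_int n *s null_root) (opH n u) + f (\<mu> - of_int n *s null_root) (- opH (- n) u)"
    by (rule dual_completion_act_two_roots)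
      (use n in \<open>auto simp: imag_fixed_def root_component_diff root_component_loop vec_eq_iff forall_3
        null_root_entries simple_root_entries hom(1)\<close>)
  ultimately show "f (\<mu> + of_int n *s null_root) (opH n u) = f (\<mu> - of_int n *s null_root) (opH (- n) u)"
    using s[OF imag_fixed[of n]] by (simp add: chi_imag_fixed[OF assms(1)])
qed

end

section \<open>Root strings\<close>

text \<open>The recursions are run downwards from the end, where \<open>X\<close> and \<open>P\<close> vanish. A step of length two
  multiplies the bounds by \<open>\<rho>\<^sup>2 \<le> 1 / 4\<close>, which leaves room for the new terms; the constants \<open>2 |c| B\<close>
  and \<open>(S + 4 |c|\<^sup>2) B\<close> reproduce themselves. That \<open>P 0\<close> is bounded
  by the \<open>a k\<close> with \<open>k \<ge> 1\<close> is what permits an induction on the depth.\<close>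

lemma downward_recursion_bound:
  fixes a X P s :: "nat \<Rightarrow> complex" and c :: complex and B S \<rho> :: real
  assumes X: "\<And>k. X k = X (k + 2) - c * a (k + 1) + c * a k"
    and P: "\<And>k. P k = P (k + 2) + s (k + 2) * a (k + 2) - c * (X (k + 1) - X (k + 2))"
    and zero: "\<And>k. k \<ge> len \<Longrightarrow> X k = 0" "\<And>k. k \<ge> len \<Longrightarrow> P k = 0"
    and a: "\<And>k. k \<ge> 1 \<Longrightarrow> cmod (a k) \<le> B * \<rho> ^ k"
    and s: "\<And>k. k \<ge> 1 \<Longrightarrow> cmod (s k * a k) \<le> S * B * \<rho> ^ k"
    and \<rho>: "0 \<le> \<rho>" "\<rho> \<le> 1 / 2" and BS: "B \<ge> 0" "S \<ge> 0"
  shows "cmod (P 0) \<le> (S + 4 * (cmod c)\<^sup>2) * B * \<rho>"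
proof -
  \<comment> \<open>only for \<open>k \<ge> 1\<close>, because \<open>X 0\<close> involves \<open>a 0\<close>\<close>
  have Xb: "cmod (X k) \<le> 2 * cmod c * B * \<rho> ^ k" if "k \<ge> 1" for k
    using that
  proof (induction "len - k" arbitrary: k rule: less_induct)
    case less
    show ?case
    proof (cases "k \<ge> len")
      case False
      have \<rho>2: "\<rho>\<^sup>2 \<le> 1 / 4" using \<rho> power_mono[of \<rho> "1/2" 2] by (simp add: power2_eq_square)
      have "cmod (X k) \<le> cmod (X (k + 2)) + cmod c * cmod (a (k + 1)) + cmod c * cmod (a k)"
        unfolding X[of k] norm_mult[symmetric]
        by (intro norm_triangle_le norm_triangle_le_diff add_mono order_refl)
      also have "\<dots> \<le> 2 * cmod c * B * \<rho> ^ (k + 2) + cmod c * (B * \<rho> ^ (k + 1)) + cmod c * (B * \<rho> ^ k)"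
        using False less.prems by (intro add_mono mult_left_mono a less.hyps) auto
      also have "\<dots> = cmod c * B * \<rho> ^ k * (2 * \<rho>\<^sup>2 + \<rho> + 1)"
        by (simp add: algebra_simps power2_eq_square)
      also have "\<dots> \<le> cmod c * B * \<rho> ^ k * 2"
        using \<rho> \<rho>2 BS by (intro mult_left_mono) auto
      finally show ?thesis by simp
    qed (use zero \<rho> BS in auto)
  qed
  define D where "D = S + 4 * (cmod c)\<^sup>2"
  have "cmod (P k) \<le> D * B * \<rho> ^ (k + 1)" for k
  proof (induction "len - k" arbitrary: k rule: less_induct)
    case less
    show ?case
    proof (cases "k \<ge> len")
      case False
      have \<rho>2: "\<rho>\<^sup>2 \<le> 1 / 4" using \<rho> power_mono[of \<rho> "1/2" 2] by (simp add: power2_eq_square)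
      have D: "D \<ge> 0" using BS by (simp add: D_def)
      have "cmod (P k) \<le> cmod (P (k + 2)) + cmod (s (k + 2) * a (k + 2))
          + cmod c * (cmod (X (k + 1)) + cmod (X (k + 2)))"
        unfolding P[of k]
        by (intro norm_triangle_le norm_triangle_le_diff add_mono order_refl)
          (auto simp: norm_mult intro!: mult_left_mono norm_triangle_ineq4)
      also have "\<dots> \<le> D * B * \<rho> ^ (k + 2 + 1) + S * B * \<rho> ^ (k + 2)
          + cmod c * (2 * cmod c * B * \<rho> ^ (k + 1) + 2 * cmod c * B * \<rho> ^ (k + 2))"
        using False by (intro add_mono mult_left_mono less.hyps s Xb) auto
      also have "\<dots> = B * \<rho> ^ (k + 1) * (D * \<rho>\<^sup>2 + S * \<rho> + 2 * (cmod c)\<^sup>2 * (1 + \<rho>))"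
        by (simp add: algebra_simps power2_eq_square)
      also have "\<dots> \<le> B * \<rho> ^ (k + 1) * (D * (1 / 4) + S * (1 / 2) + 2 * (cmod c)\<^sup>2 * (1 + 1 / 2))"
        using \<rho> \<rho>2 BS D by (intro mult_left_mono add_mono) auto
      also have "\<dots> \<le> B * \<rho> ^ (k + 1) * D"
      proof (rule mult_left_mono)
        show "D * (1 / 4) + S * (1 / 2) + 2 * (cmod c)\<^sup>2 * (1 + 1 / 2) \<le> D"
          using BS by (simp add: D_def field_simps)
      qed (use \<rho> BS in auto)
      finally show ?thesis by (simp add: algebra_simps)
    qed (use zero \<rho> BS in \<open>auto simp: D_def\<close>)
  qed
  from this[of 0] show ?thesis by (simp add: D_def)
qed

context affine_module
begin

text \<open>For root vectors \<open>e\<close>, \<open>f\<close> of weights \<open>\<beta>\<close>, \<open>-\<beta>\<close> the sphericity relations replace \<open>e\<close> by \<open>f\<close> on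
  either side of the pairing, up to terms with the factor \<open>c\<close> and at the cost of a shift of the weight by
  \<open>2\<beta>\<close>. Together with \<open>ef - fe = s(\<mu>)\<close> on vectors of weight \<open>\<mu>\<close> this gives recursions for
  \<open>X\<^sub>\<mu> = \<phi>\<^sub>\<mu>(e v\<^bsub>\<mu>-\<beta>\<^esub>)\<close> and \<open>P\<^sub>\<mu> = \<phi>\<^sub>\<mu>(f e v\<^sub>\<mu>)\<close> along the root string.\<close>

lemma root_string_bound:
  fixes \<rho> B S :: real
  assumes ew: "\<And>\<mu> u. u \<in> weight_space smul act \<mu> \<Longrightarrow> act e u \<in> weight_space smul act (\<mu> + \<beta>)"
    and fw: "\<And>\<mu> u. u \<in> weight_space smul act \<mu> \<Longrightarrow> act f u \<in> weight_space smul act (\<mu> - \<beta>)"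
    and vw: "\<And>\<mu>. v \<mu> \<in> weight_space smul act \<mu>"
    and dual: "\<And>\<mu>. \<phi> \<mu> \<in> dual_space smul (weight_space smul act \<mu>)"
    and v: "\<And>\<mu>. act e (v (\<mu> - \<beta>)) - act f (v (\<mu> + \<beta>)) = smul c (v \<mu>)"
    and \<phi>: "\<And>\<mu> u. u \<in> weight_space smul act \<mu> \<Longrightarrow>
        \<phi> (\<mu> + \<beta>) (act e u) - \<phi> (\<mu> - \<beta>) (act f u) = c * \<phi> \<mu> u"
    and comm: "\<And>\<mu> u. u \<in> weight_space smul act \<mu> \<Longrightarrow> act e (act f u) = act f (act e u) + smul (s \<mu>) u"
    and zero: "\<And>k. k \<ge> len \<Longrightarrow> v (\<mu> + of_nat k *s \<beta>) = 0"
    and a: "\<And>k. k \<ge> 1 \<Longrightarrow> cmod (\<phi> (\<mu> + of_nat k *s \<beta>) (v (\<mu> + of_nat k *s \<beta>))) \<le> B * \<rho> ^ k"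
    and s: "\<And>k. k \<ge> 1 \<Longrightarrow> cmod (s (\<mu> + of_nat k *s \<beta>) *
        \<phi> (\<mu> + of_nat k *s \<beta>) (v (\<mu> + of_nat k *s \<beta>))) \<le> S * B * \<rho> ^ k"
    and \<rho>: "0 \<le> \<rho>" "\<rho> \<le> 1 / 2" and BS: "B \<ge> 0" "S \<ge> 0"
  shows "cmod (\<phi> \<mu> (act f (act e (v \<mu>)))) \<le> (S + 4 * (cmod c)\<^sup>2) * B * \<rho>"
proof -
  note hom = dual_space_hom[OF dual subspace_weight_space]
  define a' where "a' \<nu> = \<phi> \<nu> (v \<nu>)" for \<nu>
  define X where "X \<nu> = \<phi> \<nu> (act e (v (\<nu> - \<beta>)))" for \<nu>
  define P where "P \<nu> = \<phi> \<nu> (act f (act e (v \<nu>)))" for \<nu>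
  have ev: "act e (v (\<nu> - \<beta>)) \<in> weight_space smul act \<nu>" for \<nu>
    using ew[OF vw, of "\<nu> - \<beta>"] by simp
  have fv: "act f (v (\<nu> + \<beta>)) \<in> weight_space smul act \<nu>" for \<nu>
    using fw[OF vw, of "\<nu> + \<beta>"] by simp
  have feu: "act f (act e u) \<in> weight_space smul act \<nu>" "act e (act f u) \<in> weight_space smul act \<nu>"
    if "u \<in> weight_space smul act \<nu>" for u \<nu>
    using fw[OF ew[OF that]] ew[OF fw[OF that]] by simp_all
  have two: "\<nu> + \<beta> + \<beta> = \<nu> + 2 *s \<beta>" "\<nu> + 2 *s \<beta> - \<beta> = \<nu> + \<beta>" for \<nu>
    by (simp_all add: vec_eq_iff)
  have X: "X \<nu> = X (\<nu> + 2 *s \<beta>) - c * a' (\<nu> + \<beta>) + c * a' \<nu>" for \<nu>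
  proof -
    have "X \<nu> = \<phi> \<nu> (act f (v (\<nu> + \<beta>)) + smul c (v \<nu>))"
      unfolding X_def v[symmetric] by simp
    also have "\<dots> = \<phi> \<nu> (act f (v (\<nu> + \<beta>))) + c * a' \<nu>"
      using fv vw by (simp add: hom subspace_scale[OF subspace_weight_space] a'_def)
    also have "\<phi> \<nu> (act f (v (\<nu> + \<beta>))) = X (\<nu> + 2 *s \<beta>) - c * a' (\<nu> + \<beta>)"
      using \<phi>[OF vw, of "\<nu> + \<beta>"]
      by (simp add: X_def a'_def two diff_eq_eq)
    finally show ?thesis .
  qed
  have P: "P \<nu> = P (\<nu> + 2 *s \<beta>) + s (\<nu> + 2 *s \<beta>) * a' (\<nu> + 2 *s \<beta>) - c * (X (\<nu> + \<beta>) - X (\<nu> + 2 *s \<beta>))" for \<nu>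
  proof -
    let ?\<nu> = "\<nu> + 2 *s \<beta>"
    have "P \<nu> = \<phi> ?\<nu> (act e (act e (v \<nu>))) - c * X (\<nu> + \<beta>)"
      using \<phi>[OF ew[OF vw], of \<nu>] by (simp add: P_def X_def two diff_eq_eq)
    also have "act e (v \<nu>) = act f (v ?\<nu>) + smul c (v (\<nu> + \<beta>))"
      using v[of "\<nu> + \<beta>"] unfolding two by (simp add: diff_eq_eq add.commute)
    also have "act e (act f (v ?\<nu>) + smul c (v (\<nu> + \<beta>)))
       = act f (act e (v ?\<nu>)) + smul (s ?\<nu>) (v ?\<nu>) + smul c (act e (v (?\<nu> - \<beta>)))"
      using comm[OF vw] by (simp add: two)
    also have "\<phi> ?\<nu> \<dots> = P ?\<nu> + s ?\<nu> * a' ?\<nu> + c * X ?\<nu>"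
      using feu[OF vw] vw[of ?\<nu>] ev[of ?\<nu>]
      by (simp add: hom subspace_scale[OF subspace_weight_space] subspace_add[OF subspace_weight_space]
          P_def X_def a'_def)
    finally show ?thesis by (simp add: algebra_simps)
  qed
  let ?\<mu> = "\<lambda>k. \<mu> + of_nat k *s \<beta>"
  have shift: "?\<mu> (k + 2) = ?\<mu> k + 2 *s \<beta>" "?\<mu> (k + 1) = ?\<mu> k + \<beta>" for k
    by (simp_all add: vec_eq_iff algebra_simps)
  have "cmod (P (?\<mu> 0)) \<le> (S + 4 * (cmod c)\<^sup>2) * B * \<rho>"
  proof (rule downward_recursion_bound[where X = "\<lambda>k. X (?\<mu> k)" and a = "\<lambda>k. a' (?\<mu> k)"
        and P = "\<lambda>k. P (?\<mu> k)" and s = "\<lambda>k. s (?\<mu> k)" and len = "len + 1"])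
    \<comment> \<open>\<open>X\<close> involves \<open>v\<close> at the preceding point of the string, hence the additional \<open>1\<close>\<close>
    show "X (?\<mu> k) = 0" if k: "k \<ge> len + 1" for k
    proof -
      obtain j where j: "k = j + 1" using k by (cases k) auto
      have "?\<mu> k - \<beta> = ?\<mu> j" unfolding j shift by simp
      then show ?thesis using zero[of j] k j by (simp add: X_def hom(1))
    qed
    show "P (?\<mu> k) = 0" if "k \<ge> len + 1" for k
      using zero[of k] that by (simp add: P_def hom(1))
    show "X (?\<mu> k) = X (?\<mu> (k + 2)) - c * a' (?\<mu> (k + 1)) + c * a' (?\<mu> k)" for k
      unfolding shift by (rule X)
    show "P (?\<mu> k) = P (?\<mu> (k + 2)) + s (?\<mu> (k + 2)) * a' (?\<mu> (k + 2))
        - c * (X (?\<mu> (k + 1)) - X (?\<mu> (k + 2)))" for k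
      unfolding shift by (rule P)
  qed (use a s \<rho> BS in \<open>auto simp: a'_def\<close>)
  then show ?thesis by (simp add: P_def)
qed

end

section \<open>Exponential growth of the coefficients\<close>

lemma sum_powers_le:
  fixes r :: real
  assumes "0 \<le> r" "r \<le> 1 / 2"
  shows "(\<Sum>n=1..M. r ^ n) \<le> 2 * r"
proof -
  have "(\<Sum>n=1..M. r ^ n) \<le> 2 * r * (1 - (1 / 2) ^ M)"
  proof (induction M)
    case (Suc M)
    have "r ^ Suc M \<le> r * (1 / 2) ^ M"
      using assms by (auto intro!: mult_left_mono power_mono)
    with Suc show ?case by (simp add: algebra_simps)
  qed simp
  also have "\<dots> \<le> 2 * r * 1"
    using assms by (intro mult_left_mono) auto
  finally show ?thesis by simp
qed

context integrable_irreducible_hw_module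
begin

text \<open>Along the root string of \<open>\<beta>\<close> the depth drops by \<open>p + q\<close> in each step, so the assumed
  exponential bound at smaller depth is the geometric bound that \<open>root_string_bound\<close> asks for.\<close>

lemma root_term_bound:
  fixes R C S :: real and m k p q :: int
  assumes ew: "\<And>\<mu> u. u \<in> weight_space smul act \<mu> \<Longrightarrow> act e u \<in> weight_space smul act (\<mu> + \<beta>)"
    and fw: "\<And>\<mu> u. u \<in> weight_space smul act \<mu> \<Longrightarrow> act f u \<in> weight_space smul act (\<mu> - \<beta>)"
    and vw: "\<And>\<mu>. v \<mu> \<in> weight_space smul act \<mu>"
    and dual: "\<And>\<mu>. \<phi> \<mu> \<in> dual_space smul (weight_space smul act \<mu>)"
    and v: "\<And>\<mu>. act e (v (\<mu> - \<beta>)) - act f (v (\<mu> + \<beta>)) = smul c (v \<mu>)"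
    and \<phi>: "\<And>\<mu> u. u \<in> weight_space smul act \<mu> \<Longrightarrow>
        \<phi> (\<mu> + \<beta>) (act e u) - \<phi> (\<mu> - \<beta>) (act f u) = c * \<phi> \<mu> u"
    and comm: "\<And>\<mu> u. u \<in> weight_space smul act \<mu> \<Longrightarrow> act e (act f u) = act f (act e u) + smul (s \<mu>) u"
    and \<beta>: "\<beta> = of_int p *s simple_root 0 + of_int q *s simple_root 1" "p \<ge> 0" "q \<ge> 0" "p + q \<ge> 1"
    and IH: "\<And>m' k'. m' \<ge> 0 \<Longrightarrow> k' \<ge> 0 \<Longrightarrow> m' + k' < m + k \<Longrightarrow>
        cmod (\<phi> (weight_below lam m' k') (v (weight_below lam m' k'))) \<le> C * R ^ nat (m' + k')"
    and s: "\<And>m' k'. m' \<ge> 0 \<Longrightarrow> k' \<ge> 0 \<Longrightarrow> m' \<le> m - p \<Longrightarrow> k' \<le> k - q \<Longrightarrow>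
        cmod (s (weight_below lam m' k')) \<le> S"
    and RCS: "R \<ge> 2" "C \<ge> 0" "S \<ge> 0"
  shows "cmod (\<phi> (weight_below lam m k) (act f (act e (v (weight_below lam m k)))))
    \<le> (S + 4 * (cmod c)\<^sup>2) * (C * R ^ nat (m + k)) * (1 / R) ^ nat (p + q)"
proof (rule root_string_bound[OF ew fw vw dual v \<phi> comm, where len = "nat (m + k) + 1"])
  let ?a = "\<lambda>\<nu>. \<phi> \<nu> (v \<nu>)"
  have shift: "weight_below lam m k + of_nat j *s \<beta> = weight_below lam (m - int j * p) (k - int j * q)" for j
    by (simp add: \<beta>(1) vec_eq_iff forall_3 weight_below_entries simple_root_entries algebra_simps)
  show zero: "v (weight_below lam m k + of_nat j *s \<beta>) = 0" if j: "nat (m + k) + 1 \<le> j" for j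
  proof -
    have "m + k < int j * 1" using j by linarith
    also have "\<dots> \<le> int j * (p + q)" using \<beta>(4) by (intro mult_left_mono) auto
    finally have "m - int j * p < 0 \<or> k - int j * q < 0" by (auto simp: algebra_simps)
    then show ?thesis
      unfolding shift using vw wt_trivial by blast
  qed
  show a: "cmod (?a (weight_below lam m k + of_nat j *s \<beta>))
      \<le> C * R ^ nat (m + k) * ((1 / R) ^ nat (p + q)) ^ j" if j: "1 \<le> j" for j
  proof (cases "m - int j * p \<ge> 0 \<and> k - int j * q \<ge> 0")
    case True
    define b where "b = nat (p + q)"
    have b: "int b = p + q" using \<beta>(4) by (simp add: b_def)
    have h: "m + k = (m - int j * p + (k - int j * q)) + int (b * j)"
      by (simp add: b algebra_simps)
    have "1 * 1 \<le> int j * (p + q)" using j \<beta>(4) by (intro mult_mono) auto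
    then have "m - int j * p + (k - int j * q) < m + k" by (simp add: algebra_simps)
    then have "cmod (?a (weight_below lam m k + of_nat j *s \<beta>))
        \<le> C * R ^ nat (m - int j * p + (k - int j * q))"
      unfolding shift using True by (intro IH) auto
    also have "\<dots> = C * R ^ nat (m + k) * ((1 / R) ^ b) ^ j"
    proof -
      have "nat (m + k) = nat (m - int j * p + (k - int j * q)) + b * j"
        using h True by linarith
      then show ?thesis
        using RCS(1) by (simp add: power_add power_mult[symmetric] power_one_over)
    qed
    finally show ?thesis by (simp add: b_def)
  next
    case False
    then have "v (weight_below lam (m - int j * p) (k - int j * q)) = 0"
      using vw wt_trivial by (metis not_le)
    then have "?a (weight_below lam (m - int j * p) (k - int j * q)) = 0"
      using dual_space_hom(1)[OF dual subspace_weight_space] by metis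
    then show ?thesis unfolding shift using RCS by simp
  qed
  show "cmod (s (weight_below lam m k + of_nat j *s \<beta>) * ?a (weight_below lam m k + of_nat j *s \<beta>))
      \<le> S * (C * R ^ nat (m + k)) * ((1 / R) ^ nat (p + q)) ^ j" if j: "1 \<le> j" for j
  proof (cases "m - int j * p \<ge> 0 \<and> k - int j * q \<ge> 0")
    case True
    have "1 * p \<le> int j * p" "1 * q \<le> int j * q" using j \<beta> by (intro mult_right_mono; simp)+
    then have "cmod (s (weight_below lam m k + of_nat j *s \<beta>)) \<le> S"
      unfolding shift using True by (intro s) auto
    then have "cmod (s (weight_below lam m k + of_nat j *s \<beta>) * ?a (weight_below lam m k + of_nat j *s \<beta>))
      \<le> S * (C * R ^ nat (m + k) * ((1 / R) ^ nat (p + q)) ^ j)"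
      unfolding norm_mult using a[OF j] RCS by (intro mult_mono) auto
    then show ?thesis by (simp add: mult.assoc)
  next
    case False
    then have "v (weight_below lam (m - int j * p) (k - int j * q)) = 0"
      using vw wt_trivial by (metis not_le)
    then have "?a (weight_below lam (m - int j * p) (k - int j * q)) = 0"
      using dual_space_hom(1)[OF dual subspace_weight_space] by metis
    then show ?thesis unfolding shift using RCS by simp
  qed
  have "(1 / R) ^ nat (p + q) \<le> (1 / 2) ^ nat (p + q)"
    using RCS by (intro power_mono) (auto simp: field_simps)
  also have "\<dots> \<le> (1 / 2) ^ 1"
    using \<beta>(4) by (intro power_decreasing) auto
  finally show "(1 / R) ^ nat (p + q) \<le> 1 / 2" by simp
qed (use RCS in auto)

text \<open>Induction on the depth \<open>N = m + k\<close>. The constants are chosen as follows: \<open>A N\<close> bounds the scalars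
  by which \<open>[e\<^sub>\<beta>, f\<^sub>\<beta>]\<close> acts on the weight spaces in question, and \<open>Q N\<close> adds the contribution
  of the character. The roots of the Casimir recursion then contribute at most \<open>24 Q N (1 / R) C R\<^sup>N\<close>
  in total, to be compared with the factor \<open>4 N\<close> on the other side; so \<open>R \<ge> 6 Q\<close> is what is needed.\<close>

lemma coefficient_bound:
  fixes l0 l1 :: nat
  assumes lam: "lam $ 1 = of_nat l0" "lam $ 2 = of_nat l1"
    and chi: "one_dim_rep chi"
    and \<phi>: "\<phi> \<in> dual_completion_spherical smul act chi"
    and v: "v \<in> completion_spherical smul act chi"
  shows "\<exists>C R :: real. C \<ge> 0 \<and> R \<ge> 2 \<and> (\<forall>m\<ge>0. \<forall>k\<ge>0.
    cmod (\<phi> (weight_below lam m k) (v (weight_below lam m k))) \<le> C * R ^ nat (m + k))"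
proof -
  have vw: "v \<mu> \<in> weight_space smul act \<mu>" for \<mu>
    using v by (auto simp: completion_spherical_def completion_def)
  have dual: "\<phi> \<nu> \<in> dual_space smul (weight_space smul act \<nu>)" for \<nu>
    using \<phi> by (auto simp: dual_completion_spherical_def dual_completion_def)
  note hom = dual_space_hom[OF dual subspace_weight_space]
  note rel = completion_spherical_relations[OF chi v] dual_completion_spherical_relations[OF chi \<phi>]
  define c0 where "c0 = max (cmod (chi (real_fixed 0))) (cmod (chi (real_fixed 1)))"
  have c0: "cmod (chi (real_fixed n)) \<le> c0" for n
    using chi_real_fixed_cases[OF chi, of n] by (auto simp: c0_def)
  define A where "A = real l1 + 2 + 2 * (real l0 + real l1)"
  define Q where "Q = A + 4 * c0\<^sup>2"
  define R where "R = 2 + 6 * Q"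
  define r where "r = 1 / R"
  have AQ: "A \<ge> 0" "Q \<ge> 0" by (simp_all add: A_def Q_def)
  have R: "R \<ge> 2" using AQ by (simp add: R_def)
  have r: "0 \<le> r" "r \<le> 1 / 2" "6 * Q * r \<le> 1"
    using R AQ by (simp_all add: r_def field_simps R_def)
  define a where "a m k = \<phi> (weight_below lam m k) (v (weight_below lam m k))" for m k
  define C where "C = cmod (a 0 0)"
  have "cmod (a m k) \<le> C * R ^ nat (m + k)" if "m \<ge> 0" "k \<ge> 0" for m k
    using that
  proof (induction "nat (m + k)" arbitrary: m k rule: less_induct)
    case less
    define N where "N = m + k"
    define B where "B = C * R ^ nat N"
    have B: "B \<ge> 0" using R by (simp add: B_def C_def)
    have IH: "cmod (a m' k') \<le> C * R ^ nat (m' + k')" if "m' \<ge> 0" "k' \<ge> 0" "m' + k' < m + k" for m' k'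
      using that less.hyps[of m' k'] by auto
    let ?\<mu> = "weight_below lam m k"
    let ?u = "v ?\<mu>"
    consider "N = 0" | "?u = 0" | "N \<ge> 1" "?u \<noteq> 0"
      using less.prems by (fastforce simp: N_def)
    then show ?case
    proof cases
      case 1
      then have "m = 0" "k = 0" using less.prems by (simp_all add: N_def)
      then show ?thesis by (simp add: C_def)
    next
      case 2
      then show ?thesis using B hom(1) by (simp add: a_def B_def N_def)
    next
      case 3
      define S where "S = A * of_int N"
      define T where "T = Q * of_int N * B"
      have N: "of_int N \<ge> (1::real)" "of_int N = (of_int m + of_int k :: real)"
        using 3 by (simp_all add: N_def)
      have S: "S \<ge> 0" using AQ N by (simp add: S_def)
      have T: "T \<ge> 0" using AQ N B by (simp add: T_def)
      have ST: "(S + 4 * (cmod c)\<^sup>2) * (C * R ^ nat (m + k)) * (1 / R) ^ b \<le> T * r ^ b"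
        if "cmod c \<le> c0" for c b
      proof -
        have "(cmod c)\<^sup>2 \<le> c0\<^sup>2 * 1" using that by (simp add: power_mono)
        also have "\<dots> \<le> c0\<^sup>2 * of_int N" using N by (intro mult_left_mono) auto
        finally have "S + 4 * (cmod c)\<^sup>2 \<le> Q * of_int N"
          by (simp add: S_def Q_def algebra_simps)
        then show ?thesis
          unfolding T_def r_def B_def N_def[symmetric] using B R
          by (intro mult_right_mono) (auto simp: B_def)
      qed
      \<comment> \<open>A weight \<open>\<nu> + j \<beta>\<close> with \<open>j \<ge> 1\<close> that still lies below \<open>\<lambda>\<close> forces \<open>n \<le> m\<close> for the mode \<open>n\<close> of \<open>e\<^sub>\<beta>\<close>,
        so the central terms are bounded by a multiple of the depth.\<close>
      have sb: "cmod (weight_below lam m' k' $ 2) + 2 * cmod (of_int n * level) \<le> S"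
        if "m' \<ge> 0" "k' \<ge> 0" "m' \<le> m" "k' \<le> k" "0 \<le> n" "n \<le> m" for m' k' n
      proof -
        have "weight_below lam m' k' $ 2 = of_int (int l1 + 2 * (m' - k'))"
          by (simp add: weight_below_entries lam)
        then have "cmod (weight_below lam m' k' $ 2) = \<bar>of_int (int l1 + 2 * (m' - k'))\<bar>"
          by (metis norm_of_int)
        also have "\<dots> \<le> real l1 * of_int N + 2 * of_int N"
        proof -
          have "real l1 * 1 \<le> real l1 * of_int N" using N by (intro mult_left_mono) auto
          then show ?thesis using that N by (simp add: abs_le_iff)
        qed
        finally have 1: "cmod (weight_below lam m' k' $ 2) \<le> real l1 * of_int N + 2 * of_int N" .
        have "of_int n * level = of_int (n * (int l0 + int l1))" by (simp add: lam)
        then have "cmod (of_int n * level) = of_int n * (real l0 + real l1)"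
          using that by (simp only: norm_of_int) simp
        also have "\<dots> \<le> of_int N * (real l0 + real l1)"
          using that less.prems by (intro mult_right_mono) (auto simp: N_def)
        finally show ?thesis using 1 by (simp add: S_def A_def algebra_simps)
      qed
      \<comment> \<open>the three families of positive roots: \<open>n\<delta> + \<alpha>\<^sub>1\<close>, \<open>n\<delta> - \<alpha>\<^sub>1\<close> and \<open>n\<delta>\<close>\<close>
      have "cmod (\<phi> ?\<mu> (opF (- n) (opE n ?u))) \<le> T * r ^ nat (n + (n + 1))" if "n \<ge> 0" for n
      proof (rule order_trans[OF root_term_bound[where v = v and \<phi> = \<phi> and e = "loop n sl2_e" and f = "loop (- n) sl2_f"
          and \<beta> = "of_int n *s null_root + simple_root 1" and p = n and q = "n + 1" and c = "chi (real_fixed n)" and s = "\<lambda>\<mu>. \<mu> $ 2 + of_int n * level"] ST[OF c0]])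
        show "of_int n *s null_root + simple_root 1
            = of_int n *s simple_root 0 + of_int (n + 1) *s simple_root 1"
          by (simp add: vec_eq_iff forall_3 null_root_entries simple_root_entries algebra_simps)
        show "opF (- n) u \<in> weight_space smul act (\<mu> - (of_int n *s null_root + simple_root 1))"
          if "u \<in> weight_space smul act \<mu>" for \<mu> u
          using opF_weight[OF that, of "- n"] by (simp add: algebra_simps)
        show "opE n (opF (- n) u) = opF (- n) (opE n u) + smul (\<mu> $ 2 + of_int n * level) u"
          if "u \<in> weight_space smul act \<mu>" for \<mu> u
          using that by (simp add: opE_opF[of n "- n"] central_act weight_space_iff chev_h_1
              scale_left_distrib scale_right_distrib distrib_left add.assoc)
        show "cmod (weight_below lam m' k' $ 2 + of_int n * level) \<le> S"
          if "m' \<ge> 0" "k' \<ge> 0" "m' \<le> m - n" "k' \<le> k - (n + 1)" for m' k'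
          using sb[of m' k' n] that \<open>n \<ge> 0\<close> norm_triangle_ineq[of "weight_below lam m' k' $ 2" "of_int n * level"]
            norm_ge_zero[of "of_int n * level"] by linarith
      qed (use opE_weight vw dual rel that R S IH C_def a_def in auto)
      moreover have "cmod (\<phi> ?\<mu> (opE (- n) (opF n ?u))) \<le> T * r ^ nat (n + (n - 1))" if "n \<ge> 1" for n
      proof (rule order_trans[OF root_term_bound[where v = v and \<phi> = \<phi> and e = "loop n sl2_f" and f = "loop (- n) sl2_e"
          and \<beta> = "of_int n *s null_root - simple_root 1" and p = n and q = "n - 1" and c = "- chi (real_fixed (- n))" and s = "\<lambda>\<mu>. - (\<mu> $ 2) + of_int n * level"] ST])
        show "cmod (- chi (real_fixed (- n))) \<le> c0" using c0 by simp
        show "of_int n *s null_root - simple_root 1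
            = of_int n *s simple_root 0 + of_int (n - 1) *s simple_root 1"
          by (simp add: vec_eq_iff forall_3 null_root_entries simple_root_entries algebra_simps)
        show "opE (- n) u \<in> weight_space smul act (\<mu> - (of_int n *s null_root - simple_root 1))"
          if "u \<in> weight_space smul act \<mu>" for \<mu> u
          using opE_weight[OF that, of "- n"] by (simp add: algebra_simps)
        have sym: "\<mu> - (of_int n *s null_root - simple_root 1) = \<mu> + (of_int (- n) *s null_root + simple_root 1)"
          "\<mu> + (of_int n *s null_root - simple_root 1) = \<mu> - (of_int (- n) *s null_root + simple_root 1)" for \<mu>
          by (simp_all add: algebra_simps)
        show "opF n (v (\<mu> - (of_int n *s null_root - simple_root 1)))
            - opE (- n) (v (\<mu> + (of_int n *s null_root - simple_root 1)))
            = smul (- chi (real_fixed (- n))) (v \<mu>)" for \<mu>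
          unfolding sym scale_minus_left rel(1)[symmetric] by simp
        show "\<phi> (\<mu> + (of_int n *s null_root - simple_root 1)) (opF n u)
            - \<phi> (\<mu> - (of_int n *s null_root - simple_root 1)) (opE (- n) u)
            = - chi (real_fixed (- n)) * \<phi> \<mu> u" if "u \<in> weight_space smul act \<mu>" for \<mu> u
          unfolding sym mult_minus_left rel(3)[OF that, symmetric] by simp
        show "opF n (opE (- n) u) = opE (- n) (opF n u) + smul (- (\<mu> $ 2) + of_int n * level) u"
          if "u \<in> weight_space smul act \<mu>" for \<mu> u
          using that opE_opF[of "- n" n u] by (simp add: central_act weight_space_iff chev_h_1
              scale_left_distrib scale_left_diff_distrib algebra_simps)
        show "cmod (- (weight_below lam m' k' $ 2) + of_int n * level) \<le> S"
          if "m' \<ge> 0" "k' \<ge> 0" "m' \<le> m - n" "k' \<le> k - (n - 1)" for m' k'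
          using sb[of m' k' n] that \<open>n \<ge> 1\<close> norm_triangle_ineq[of "- (weight_below lam m' k' $ 2)" "of_int n * level"]
            norm_ge_zero[of "of_int n * level"] unfolding norm_minus_cancel by linarith
      qed (use opF_weight vw dual that R S IH C_def a_def in auto)
      moreover have "cmod (\<phi> ?\<mu> (opH (- n) (opH n ?u))) \<le> T * r ^ nat (n + n)" if "n \<ge> 1" for n
      proof (rule order_trans[OF root_term_bound[where v = v and \<phi> = \<phi> and e = "loop n sl2_h" and f = "loop (- n) sl2_h"
          and \<beta> = "of_int n *s null_root" and p = n and q = "n" and c = "0" and s = "\<lambda>\<mu>. 2 * (of_int n * level)"] ST])
        show "cmod 0 \<le> c0" by (simp add: c0_def le_max_iff_disj)
        show "of_int n *s null_root = of_int n *s simple_root 0 + of_int n *s simple_root 1"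
          by (simp add: vec_eq_iff forall_3 null_root_entries simple_root_entries)
        show "opH (- n) u \<in> weight_space smul act (\<mu> - of_int n *s null_root)"
          if "u \<in> weight_space smul act \<mu>" for \<mu> u
          using opH_weight[OF that, of "- n"] by simp
        show "opH n (v (\<mu> - of_int n *s null_root)) - opH (- n) (v (\<mu> + of_int n *s null_root))
            = smul 0 (v \<mu>)" for \<mu>
          using rel(2)[of n] \<open>n \<ge> 1\<close> by simp
        show "\<phi> (\<mu> + of_int n *s null_root) (opH n u) - \<phi> (\<mu> - of_int n *s null_root) (opH (- n) u)
            = 0 * \<phi> \<mu> u" if "u \<in> weight_space smul act \<mu>" for \<mu> u
          using rel(4)[OF that, of n] \<open>n \<ge> 1\<close> by simp
        show "opH n (opH (- n) u) = opH (- n) (opH n u) + smul (2 * (of_int n * level)) u"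
          if "u \<in> weight_space smul act \<mu>" for \<mu> u
          by (simp add: opH_opH[of n "- n"] central_act scale_left_distrib scale_right_distrib
              distrib_left mult.assoc)
        show "cmod (2 * (of_int n * level)) \<le> S"
          if "m' \<ge> 0" "k' \<ge> 0" "m' \<le> m - n" "k' \<le> k - n" for m' k'
          using sb[of m' k' n] that \<open>n \<ge> 1\<close> norm_ge_zero[of "weight_below lam m' k' $ 2"]
          unfolding norm_mult[of 2] norm_numeral by linarith
      qed (use opH_weight vw dual that R S IH C_def a_def in auto)
      ultimately have bounds:
        "\<And>n. n \<ge> 0 \<Longrightarrow> cmod (\<phi> ?\<mu> (opF (- n) (opE n ?u))) \<le> T * r ^ nat (n + (n + 1))"
        "\<And>n. n \<ge> 1 \<Longrightarrow> cmod (\<phi> ?\<mu> (opE (- n) (opF n ?u))) \<le> T * r ^ nat (n + (n - 1))"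
        "\<And>n. n \<ge> 1 \<Longrightarrow> cmod (\<phi> ?\<mu> (opH (- n) (opH n ?u))) \<le> T * r ^ nat (n + n)"
        by blast+
      have w: "opF (- n) (opE n ?u) \<in> weight_space smul act ?\<mu>"
        "opE (- n) (opF n ?u) \<in> weight_space smul act ?\<mu>"
        "opH (- n) (opH n ?u) \<in> weight_space smul act ?\<mu>" for n
        using opF_weight[OF opE_weight[OF vw], of "-n" n ?\<mu>] opE_weight[OF opF_weight[OF vw], of "-n" n ?\<mu>]
          opH_weight[OF opH_weight[OF vw], of "-n" n ?\<mu>] by (simp_all add: algebra_simps)
      note sub = subspace_scale[OF subspace_weight_space] subspace_add[OF subspace_weight_space]
      have mw: "casimir_mode n ?u \<in> weight_space smul act ?\<mu>" for n
        unfolding casimir_mode_def using w by (intro sub)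
      have mode: "cmod (\<phi> ?\<mu> (casimir_mode (int n) ?u)) \<le> 5 * T * r ^ n" if "n \<ge> 1" for n
      proof -
        have pw: "T * r ^ nat b \<le> T * r ^ n" if "b \<ge> int n" for b
          using that r T by (intro mult_left_mono power_decreasing) auto
        have "\<phi> ?\<mu> (casimir_mode (int n) ?u) = 2 * \<phi> ?\<mu> (opE (- int n) (opF (int n) ?u))
            + 2 * \<phi> ?\<mu> (opF (- int n) (opE (int n) ?u)) + \<phi> ?\<mu> (opH (- int n) (opH (int n) ?u))"
          unfolding casimir_mode_def using w by (simp add: hom sub)
        also have "cmod \<dots> \<le> 2 * (T * r ^ n) + 2 * (T * r ^ n) + T * r ^ n"
          using that bounds[of "int n"] pw
          by (intro norm_triangle_le add_mono) (auto simp: norm_mult intro: order_trans)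
        finally show ?thesis by simp
      qed
      obtain M where M: "smul (4 * (lam $ 1 * of_int m + lam $ 2 * of_int k - (of_int (m - k))\<^sup>2
            + of_int (m + k))) ?u
          = smul 4 (opF 0 (opE 0 ?u)) + smul 2 (\<Sum>n=1..M. casimir_mode (int n) ?u)"
        using casimir_recursion[OF vw] by blast
      define D where "D = int l0 * m + int l1 * k - (m - k)\<^sup>2 + N"
      have D: "D \<ge> N"
        using weights_in_paraboloid[OF lam vw 3(2)] by (simp add: D_def)
      have "4 * of_int D * a m k
          = \<phi> ?\<mu> (smul (4 * (lam $ 1 * of_int m + lam $ 2 * of_int k - (of_int (m - k))\<^sup>2
            + of_int (m + k))) ?u)"
        using vw by (simp add: hom(2) a_def D_def N_def lam)
      also have "\<dots> = 4 * \<phi> ?\<mu> (opF 0 (opE 0 ?u)) + 2 * (\<Sum>n=1..M. \<phi> ?\<mu> (casimir_mode (int n) ?u))"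
        unfolding M using w[of 0] mw by (simp add: hom sub subspace_sum[OF subspace_weight_space])
      also have "cmod \<dots> \<le> 4 * (T * r) + 2 * (\<Sum>n=1..M. 5 * T * r ^ n)"
      proof -
        have "cmod (\<phi> ?\<mu> (opF 0 (opE 0 ?u))) \<le> T * r" using bounds(1)[of 0] by simp
        moreover have "cmod (\<Sum>n=1..M. \<phi> ?\<mu> (casimir_mode (int n) ?u)) \<le> (\<Sum>n=1..M. 5 * T * r ^ n)"
          using mode by (intro sum_norm_le) auto
        ultimately show ?thesis
          by (intro norm_triangle_le add_mono) (auto simp: norm_mult)
      qed
      also have "\<dots> = 4 * (T * r) + 10 * T * (\<Sum>n=1..M. r ^ n)"
        by (simp add: sum_distrib_left mult.assoc)
      also have "\<dots> \<le> 4 * (T * r) + 10 * T * (2 * r)"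
        using sum_powers_le[OF r(1,2), of M] T by (intro add_mono mult_left_mono) auto
      also have "\<dots> = 4 * of_int N * (6 * Q * r * B)"
        by (simp add: T_def)
      also have "\<dots> \<le> 4 * of_int N * (1 * B)"
        using r B N by (intro mult_left_mono mult_right_mono) auto
      finally have "4 * of_int D * cmod (a m k) \<le> 4 * of_int N * B"
        using D 3(1) by (simp add: norm_mult)
      moreover have "4 * of_int N * cmod (a m k) \<le> 4 * of_int D * cmod (a m k)"
        using D by (intro mult_right_mono) auto
      ultimately have "4 * of_int N * cmod (a m k) \<le> 4 * of_int N * B" by linarith
      then show ?thesis using N by (simp add: B_def N_def)
    qed
  qed
  then show ?thesis
    using R by (intro exI[of _ C] exI[of _ R]) (auto simp: a_def C_def)
qed

end

section \<open>Convergence\<close>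

lemma weight_form_weight_below:
  "weight_form (weight_below lam m n) weyl_vector = lam $ 2 / 2 + 2 * lam $ 3 - of_int (m + n)"
  unfolding weight_form_def cartan_form_coweight
  by (simp add: coweight_def weight_eval_def weyl_vector_def fund_weight_def chev_h_def loop_def
      central_def degree_d_def affine_scale_def lookup_map_scale lookup_add sl2_h_def
      weight_below_entries algebra_simps)

lemma weight_below_level: "weight_eval (weight_below lam m n) central = lam $ 1 + lam $ 2"
  by (simp add: weight_eval_def central_def weight_below_entries)

lemma weight_below_lattice:
  assumes "lam \<in> weight_lattice"
  shows "weight_below lam m n \<in> weight_lattice"
  using assms
  by (simp add: weight_lattice_def weight_eval_basis weight_below_entries del: One_nat_def)

lemma norm_weight_exp:
  assumes "lam $ 1 = of_nat l0" "lam $ 2 = of_nat l1" "lam $ 3 = 0"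
  shows "cmod (weight_exp (weight_below lam m n) (z, u, \<tau>)) =
    exp (- pi * ((real l1 + 2 * of_int (m - n)) * Im z + (real l0 + real l1) * Im u + of_int m * Im \<tau>))"
proof -
  have "weight_exp (weight_below lam m n) (z, u, \<tau>) =
      exp (of_real pi * \<i> * (of_real (real l1 + 2 * of_int (m - n)) * z + of_real (real l0 + real l1) * u
        + of_real (of_int m) * \<tau>))"
    unfolding weight_exp_def prod.case Let_def weight_eval_basis weight_below_level
    by (intro arg_cong[where f = exp]) (simp add: weight_below_entries assms field_simps)
  then show ?thesis
    by (simp add: norm_exp_eq_Re algebra_simps)
qed

text \<open>The exponent is \<open>- \<pi>\<close> times \<open>(m + n) Im \<tau> / 2 + (m - n) (Im \<tau> + 4 Im z) / 2\<close> plus terms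
  independent of \<open>m\<close> and \<open>n\<close>. Here \<open>|Im \<tau> + 4 Im z| \<le> Im \<tau>\<close> on \<open>D\<close>, and the paraboloid condition gives
  \<open>|m - n| \<le> (m + n + L) / 2\<close> with \<open>L = l0 + l1\<close> by the inequality of arithmetic and geometric means.
  This leaves half of the first term, uniformly in \<open>z\<close>.\<close>

lemma norm_weight_exp_le:
  fixes m n l0 l1 :: nat
  assumes lam: "lam $ 1 = of_nat l0" "lam $ 2 = of_nat l1" "lam $ 3 = 0"
    and par: "(int m - int n)\<^sup>2 \<le> int l0 * int m + int l1 * int n"
    and z: "- Im \<tau> / 2 < Im z" "Im z < 0"
  shows "cmod (weight_exp (weight_below lam (int m) (int n)) (z, u, \<tau>)) \<le>
    exp (pi * (real l0 + real l1) * (\<bar>Im u\<bar> + Im \<tau>)) * exp (- pi * Im \<tau> / 4) ^ (m + n)"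
proof -
  define L where "L = real l0 + real l1"
  define t where "t = Im \<tau>"
  define y where "y = Im z"
  define s where "s = real m + real n"
  define d where "d = real m - real n"
  have yt: "- t / 2 < y" "y < 0" "t > 0" using z by (simp_all add: t_def y_def)
  have "real_of_int ((int m - int n)\<^sup>2) \<le> real_of_int (int l0 * int m + int l1 * int n)"
    using par by (rule of_int_le_iff[THEN iffD2])
  then have "d\<^sup>2 \<le> real l0 * real m + real l1 * real n" by (simp add: d_def)
  also have "\<dots> \<le> L * s"
    by (simp add: L_def s_def algebra_simps)
  also have "\<dots> \<le> ((s + L) / 2)\<^sup>2"
    using sum_squares_bound[of s L] by (simp add: power2_eq_square field_simps)
  finally have d: "\<bar>d\<bar> \<le> (s + L) / 2"
    using abs_le_square_iff[of d "(s + L) / 2"] by (simp add: s_def L_def)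
  have "\<bar>d * (t + 4 * y)\<bar> \<le> (s + L) / 2 * t"
    unfolding abs_mult using d yt by (intro mult_mono) (auto simp: s_def L_def)
  then have 1: "d * (t + 4 * y) \<ge> - ((s + L) / 2 * t)" by linarith
  have 2: "real l1 * y \<ge> - (L * t / 2)"
  proof -
    have "real l1 * (- y) \<le> L * (t / 2)"
      using yt by (intro mult_mono) (auto simp: L_def)
    then show ?thesis by simp
  qed
  have 3: "L * Im u \<ge> - (L * \<bar>Im u\<bar>)"
  proof -
    have "L * (- Im u) \<le> L * \<bar>Im u\<bar>" by (rule mult_left_mono) (auto simp: L_def)
    then show ?thesis by simp
  qed
  have "(real l1 + 2 * d) * y + L * Im u + real m * t
      = real l1 * y + L * Im u + s * t / 2 + d * (t + 4 * y) / 2"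
    by (simp add: s_def d_def field_simps)
  also have "\<dots> \<ge> - (L * t / 2) - L * \<bar>Im u\<bar> + s * t / 2 - (s + L) / 2 * t / 2"
    using 1 2 3 by linarith
  finally have "(real l1 + 2 * d) * y + L * Im u + real m * t \<ge> s * t / 4 - L * (\<bar>Im u\<bar> + 3 / 4 * t)"
    by (simp add: field_simps)
  moreover have "L * (\<bar>Im u\<bar> + 3 / 4 * t) \<le> L * (\<bar>Im u\<bar> + t)"
    using yt by (intro mult_left_mono) (auto simp: L_def)
  ultimately have "(real l1 + 2 * d) * y + L * Im u + real m * t \<ge> s * t / 4 - L * (\<bar>Im u\<bar> + t)"
    by linarith
  then have "pi * (s * t / 4 - L * (\<bar>Im u\<bar> + t)) \<le> pi * ((real l1 + 2 * d) * y + L * Im u + real m * t)"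
    by (intro mult_left_mono) auto
  then have "- pi * ((real l1 + 2 * d) * y + L * Im u + real m * t)
      \<le> pi * L * (\<bar>Im u\<bar> + t) + real (m + n) * (- pi * t / 4)"
    by (simp add: s_def algebra_simps)
  then have "exp (- pi * ((real l1 + 2 * d) * y + L * Im u + real m * t))
      \<le> exp (pi * L * (\<bar>Im u\<bar> + t)) * exp (- pi * t / 4) ^ (m + n)"
    by (simp add: exp_add[symmetric] exp_of_nat_mult[symmetric] algebra_simps)
  then show ?thesis
    unfolding norm_weight_exp[OF lam] by (simp add: L_def t_def y_def d_def)
qed

lemma summable_half_powers:
  "(\<lambda>(m :: nat, n :: nat). (1 / 2 :: real) ^ (m + n)) summable_on UNIV"
proof -
  have g: "((\<lambda>n :: nat. (1 / 2 :: real) ^ n) has_sum 2) UNIV"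
  proof (rule norm_summable_imp_has_sum)
    show "(\<lambda>n. (1 / 2 :: real) ^ n) sums 2"
      using geometric_sums[of "1 / 2 :: real"] by simp
  qed (simp add: norm_power)
  have "(\<lambda>(m :: nat, n :: nat). (1 / 2 :: real) ^ (m + n)) summable_on (UNIV \<times> UNIV)"
  proof (rule summable_on_SigmaI)
    fix m :: nat
    show "((\<lambda>n. case (m, n) of (m, n) \<Rightarrow> (1 / 2 :: real) ^ (m + n)) has_sum ((1 / 2) ^ m * 2)) UNIV"
      using has_sum_cmult_right[OF g, of "(1 / 2) ^ m"] by (simp add: power_add)
    show "(\<lambda>m :: nat. (1 / 2 :: real) ^ m * 2) summable_on UNIV"
      using has_sum_cmult_left[OF g, of 2] by (rule has_sum_imp_summable)
  qed auto
  then show ?thesis by simp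
qed

text \<open>Beyond \<open>T\<close> the decay \<open>exp(- \<pi> Im \<tau> / 4)\<close> per unit of depth turns the growth factor \<open>R\<close> into at most
  \<open>1 / 2\<close>, so the series \<open>\<Sum> (1 / 2)\<^bsup>m+n\<^esup>\<close> is a majorant.\<close>

lemma converges_on_of_exponential_bound:
  fixes a :: "weight \<Rightarrow> complex" and l0 l1 :: nat and C R :: real
  assumes lam: "lam $ 1 = of_nat l0" "lam $ 2 = of_nat l1" "lam $ 3 = 0"
    and support: "\<And>\<mu>. a \<mu> \<noteq> 0 \<Longrightarrow> \<exists>m n :: nat. \<mu> = weight_below lam (int m) (int n) \<and>
        (int m - int n)\<^sup>2 \<le> int l0 * int m + int l1 * int n"
    and bound: "\<And>m n :: nat. cmod (a (weight_below lam (int m) (int n))) \<le> C * R ^ (m + n)"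
    and CR: "C \<ge> 0" "R \<ge> 1"
  shows "\<exists>T\<ge>0. converges_on a {(z, u, \<tau>) \<in> D_region. Im \<tau> > T}"
proof -
  define T where "T = 4 * ln (2 * R) / pi"
  define U where "U = {(z :: complex, u :: complex, \<tau>) \<in> D_region. Im \<tau> > T}"
  define w where "w = (\<lambda>(m, n). weight_below lam (int m) (int n))"
  have inj: "inj w"
    by (auto simp: inj_def w_def weight_below_eq_iff)
  have T: "T \<ge> 0" using CR by (simp add: T_def)
  have lattice: "w p \<in> weight_lattice" for p
  proof -
    have "lam \<in> weight_lattice"
      by (simp add: weight_lattice_def weight_eval_basis lam del: One_nat_def)
    then show ?thesis by (cases p) (simp add: w_def weight_below_lattice)
  qed
  have support': "\<mu> \<in> range w" if "a \<mu> \<noteq> 0" for \<mu>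
    using support[OF that] by (auto simp: w_def)
  have half: "R * exp (- pi * t / 4) \<le> 1 / 2" if "t > T" for t
  proof -
    have "ln (2 * R) \<le> pi * t / 4" using that by (simp add: T_def field_simps)
    then have "2 * R \<le> exp (pi * t / 4)"
      using CR by (simp add: ln_ge_iff[symmetric] ln_le_cancel_iff[of _ "exp _", symmetric] del: ln_le_cancel_iff)
    then show ?thesis by (simp add: exp_minus field_simps)
  qed
  \<comment> \<open>a majorant that is uniform for bounded \<open>Im u\<close> and \<open>Im \<tau>\<close>\<close>
  define G where "G b \<mu> = (if \<mu> \<in> range w then
      C * exp (pi * (real l0 + real l1) * b) * (case inv w \<mu> of (m, n) \<Rightarrow> (1 / 2) ^ (m + n)) else 0)" for b \<mu>
  have G: "G b summable_on weight_lattice" for b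
  proof -
    have "(\<lambda>p. C * exp (pi * (real l0 + real l1) * b) * (case p of (m, n) \<Rightarrow> (1 / 2) ^ (m + n)))
        summable_on (UNIV :: (nat \<times> nat) set)"
      by (intro summable_on_cmult_right summable_half_powers)
    then have "(G b \<circ> w) summable_on UNIV"
      using inj by (simp add: G_def o_def)
    then have "G b summable_on range w"
      using summable_on_reindex[OF inj, of "G b"] by simp
    then show ?thesis
      by (rule summable_on_cong_neutral[THEN iffD1, rotated -1]) (use lattice in \<open>auto simp: G_def\<close>)
  qed
  have le_G: "cmod (a \<mu> * weight_exp \<mu> (z, u, \<tau>)) \<le> G b \<mu>"
    if "(z, u, \<tau>) \<in> U" "\<bar>Im u\<bar> + Im \<tau> \<le> b" for \<mu> z u \<tau> b
  proof (cases "a \<mu> = 0")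
    case True
    then show ?thesis using CR by (auto simp: G_def split: prod.split)
  next
    case False
    then obtain m n :: nat where mn: "\<mu> = weight_below lam (int m) (int n)"
        "(int m - int n)\<^sup>2 \<le> int l0 * int m + int l1 * int n"
      using support by blast
    have \<mu>: "\<mu> = w (m, n)" by (simp add: mn w_def)
    let ?x = "exp (- pi * Im \<tau> / 4)"
    let ?E = "exp (pi * (real l0 + real l1) * b)"
    have "- Im \<tau> / 2 < Im z" "Im z < 0" "Im \<tau> > T"
      using that by (auto simp: U_def D_region_def)
    then have "cmod (weight_exp \<mu> (z, u, \<tau>)) \<le> exp (pi * (real l0 + real l1) * (\<bar>Im u\<bar> + Im \<tau>)) * ?x ^ (m + n)"
      unfolding mn(1) by (intro norm_weight_exp_le lam mn(2))
    also have "\<dots> \<le> ?E * ?x ^ (m + n)"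
      using that by (intro mult_right_mono) (auto intro!: mult_left_mono)
    finally have "cmod (a \<mu> * weight_exp \<mu> (z, u, \<tau>)) \<le> C * R ^ (m + n) * (?E * ?x ^ (m + n))"
      unfolding norm_mult using bound[of m n] CR by (intro mult_mono) (auto simp: mn(1))
    also have "\<dots> = C * ?E * (R * ?x) ^ (m + n)"
      by (simp add: power_mult_distrib)
    also have "\<dots> \<le> C * ?E * (1 / 2) ^ (m + n)"
      using half[OF \<open>Im \<tau> > T\<close>] CR by (intro mult_left_mono power_mono) auto
    also have "\<dots> = G b \<mu>"
      using inj by (simp add: G_def \<mu>)
    finally show ?thesis .
  qed
  have algebra: "a \<in> completed_group_algebra"
    unfolding completed_group_algebra_def
  proof (intro CollectI conjI allI impI)
    show "\<mu> \<in> weight_lattice" if "a \<mu> \<noteq> 0" for \<mu>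
      using support'[OF that] lattice by auto
    have "{K. \<exists>\<mu>\<in>level_lattice K. a \<mu> \<noteq> 0} \<subseteq> {int l0 + int l1}"
    proof clarify
      fix K \<mu> assume "\<mu> \<in> level_lattice K" "a \<mu> \<noteq> 0"
      then have "of_int K = (of_nat l0 + of_nat l1 :: complex)"
        using support'[of \<mu>] by (auto simp: level_lattice_def w_def weight_below_level lam)
      then have "of_int K = (of_int (int l0 + int l1) :: complex)" by simp
      then show "K = int l0 + int l1" by (simp only: of_int_eq_iff)
    qed
    then show "finite {K. \<exists>\<mu>\<in>level_lattice K. a \<mu> \<noteq> 0}"
      using finite_subset by blast
    fix K :: int and N :: real
    define B where "B = nat \<lceil>real l1 / 2 - N\<rceil>"
    have "{\<mu> \<in> level_lattice K. a \<mu> \<noteq> 0 \<and> N \<le> Re (weight_form \<mu> weyl_vector)} \<subseteq> w ` ({..B} \<times> {..B})"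
    proof clarify
      fix \<mu> assume "a \<mu> \<noteq> 0" and N: "N \<le> Re (weight_form \<mu> weyl_vector)"
      obtain m n where \<mu>: "\<mu> = w (m, n)"
        using support'[OF \<open>a \<mu> \<noteq> 0\<close>] by auto
      have "N \<le> real l1 / 2 - (real m + real n)"
        using N by (simp add: \<mu> w_def weight_form_weight_below lam)
      then have "m \<le> B" "n \<le> B" unfolding B_def by linarith+
      then show "\<mu> \<in> w ` ({..B} \<times> {..B})" by (auto simp: \<mu>)
    qed
    then show "finite {\<mu> \<in> level_lattice K. a \<mu> \<noteq> 0 \<and> N \<le> Re (weight_form \<mu> weyl_vector)}"
      using finite_subset by blast
  qed
  have U_eq: "U = {p. 0 < Im (snd (snd p)) \<and> - Im (snd (snd p)) / 2 < Im (fst p) \<and> Im (fst p) < 0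
      \<and> T < Im (snd (snd p))}"
    by (auto simp: U_def D_region_def Y_space_def)
  have open_U: "open U"
    unfolding U_eq by (intro open_Collect_conj open_Collect_less continuous_intros) auto
  have "converges_on a U"
    unfolding converges_on_def
  proof (intro conjI ballI)
    show "a \<in> completed_group_algebra" by (rule algebra)
    show "open U" by (rule open_U)
    show "U \<subseteq> Y_space" by (auto simp: U_eq Y_space_def)
  next
    fix p assume p: "p \<in> U"
    obtain z u \<tau> where zu: "p = (z, u, \<tau>)" by (cases p)
    show "(\<lambda>\<mu>. norm (a \<mu> * weight_exp \<mu> p)) summable_on weight_lattice"
      unfolding zu by (rule Infinite_Sum.abs_summable_on_comparison_test'[OF G le_G[OF _ order_refl]]) (use p zu in auto)
    define W where "W = U \<inter> {p. \<bar>Im (fst (snd p))\<bar> + Im (snd (snd p)) < \<bar>Im u\<bar> + Im \<tau> + 1}"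
    have "uniform_limit W (\<lambda>F x. \<Sum>\<mu>\<in>F. a \<mu> * weight_exp \<mu> x)
          (\<lambda>x. \<Sum>\<^sub>\<infinity>\<mu>\<in>weight_lattice. a \<mu> * weight_exp \<mu> x) (finite_subsets_at_top weight_lattice)"
    proof (rule Weierstrass_m_test_general[OF _ G[of "\<bar>Im u\<bar> + Im \<tau> + 1"]])
      fix \<mu> x assume "x \<in> W"
      then show "norm (a \<mu> * weight_exp \<mu> x) \<le> G (\<bar>Im u\<bar> + Im \<tau> + 1) \<mu>"
        by (cases x) (auto simp: W_def intro!: le_G)
    qed
    moreover have "open W"
      unfolding W_def by (intro open_Int open_U open_Collect_less continuous_intros)
    moreover have "p \<in> W" using p by (simp add: W_def zu)
    ultimately show "\<exists>W. open W \<and> p \<in> W \<and> W \<subseteq> U \<and>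
        uniform_limit W (\<lambda>F x. \<Sum>\<mu>\<in>F. a \<mu> * weight_exp \<mu> x)
          (\<lambda>x. \<Sum>\<^sub>\<infinity>\<mu>\<in>weight_lattice. a \<mu> * weight_exp \<mu> x)
          (finite_subsets_at_top weight_lattice)"
      by (intro exI[of _ W]) (auto simp: W_def)
  qed
  then show ?thesis
    using T unfolding U_def by blast
qed

section \<open>Spherical functions\<close>

context integrable_irreducible_hw_module
begin

lemma Psi_support:
  fixes l0 l1 :: nat
  assumes lam: "lam $ 1 = of_nat l0" "lam $ 2 = of_nat l1"
    and \<phi>: "set \<phi> \<subseteq> dual_completion_spherical smul act chi \<times> completion_spherical smul act chi"
    and "Psi \<phi> \<mu> \<noteq> 0"
  shows "\<exists>m n :: nat. \<mu> = weight_below lam (int m) (int n) \<and>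
    (int m - int n)\<^sup>2 \<le> int l0 * int m + int l1 * int n"
proof -
  obtain f v where fv: "(f, v) \<in> set \<phi>" "f \<mu> (v \<mu>) \<noteq> 0"
  proof (rule ccontr)
    assume "\<not> thesis"
    then have "map (\<lambda>(f, v). f \<mu> (v \<mu>)) \<phi> = map (\<lambda>_. 0) \<phi>"
      using that by (intro map_cong refl) auto
    then have "Psi \<phi> \<mu> = sum_list (map (\<lambda>_. 0) \<phi>)"
      unfolding Psi_def by (rule arg_cong)
    then show False
      using \<open>Psi \<phi> \<mu> \<noteq> 0\<close> by simp
  qed
  then have f: "f \<mu> \<in> dual_space smul (weight_space smul act \<mu>)" and v: "v \<mu> \<in> weight_space smul act \<mu>"
    using \<phi> by (auto simp: dual_completion_spherical_def dual_completion_def completion_spherical_def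
        completion_def)
  have "v \<mu> \<noteq> 0"
    using fv(2) dual_space_hom(1)[OF f subspace_weight_space] by auto
  moreover from weight_space_support[OF v this] obtain m n :: nat
    where mn: "\<mu> = weight_below lam (int m) (int n)" by blast
  ultimately show ?thesis
    using weights_in_paraboloid[OF lam, of "v \<mu>" "int m" "int n"] v by auto
qed

lemma Psi_bound:
  fixes l0 l1 :: nat
  assumes lam: "lam $ 1 = of_nat l0" "lam $ 2 = of_nat l1"
    and chi: "one_dim_rep chi"
    and \<phi>: "set \<phi> \<subseteq> dual_completion_spherical smul act chi \<times> completion_spherical smul act chi"
  shows "\<exists>C R :: real. C \<ge> 0 \<and> R \<ge> 1 \<and> (\<forall>m n :: nat.
    cmod (Psi \<phi> (weight_below lam (int m) (int n))) \<le> C * R ^ (m + n))"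
  using \<phi>
proof (induction \<phi>)
  case Nil
  show ?case by (intro exI[of _ 0] exI[of _ 1]) (simp add: Psi_def)
next
  case (Cons p \<phi>)
  obtain f v where p: "p = (f, v)" by (cases p)
  obtain C R :: real where IH: "C \<ge> 0" "R \<ge> 1"
    "\<And>m n :: nat. cmod (Psi \<phi> (weight_below lam (int m) (int n))) \<le> C * R ^ (m + n)"
    using Cons by auto
  obtain C' R' :: real where fv: "C' \<ge> 0" "R' \<ge> 2"
    "\<And>m n. m \<ge> 0 \<Longrightarrow> n \<ge> 0 \<Longrightarrow>
      cmod (f (weight_below lam m n) (v (weight_below lam m n))) \<le> C' * R' ^ nat (m + n)"
    using coefficient_bound[OF lam chi, of f v] Cons.prems by (auto simp: p)
  have "cmod (Psi (p # \<phi>) (weight_below lam (int m) (int n))) \<le> (C' + C) * max R' R ^ (m + n)" for m n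
  proof -
    let ?\<mu> = "weight_below lam (int m) (int n)"
    have "cmod (Psi (p # \<phi>) ?\<mu>) \<le> cmod (f ?\<mu> (v ?\<mu>)) + cmod (Psi \<phi> ?\<mu>)"
      by (simp add: Psi_def p norm_triangle_ineq)
    also have "\<dots> \<le> C' * R' ^ (m + n) + C * R ^ (m + n)"
      using fv(3)[of "int m" "int n"] IH(3) by (intro add_mono) (auto simp: nat_int_add)
    also have "\<dots> \<le> C' * max R' R ^ (m + n) + C * max R' R ^ (m + n)"
      using fv IH by (intro add_mono mult_left_mono power_mono) auto
    finally show ?thesis by (simp add: algebra_simps)
  qed
  then show ?case
    using fv IH by (intro exI[of _ "C' + C"] exI[of _ "max R' R"]) auto
qed

end

theorem proposition5p6:
  fixes K :: nat
    and chi :: "affine \<Rightarrow> complex"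
    and lam :: weight
    and smul :: "complex \<Rightarrow> 'v::ab_group_add \<Rightarrow> 'v"
    and act :: "affine \<Rightarrow> 'v \<Rightarrow> 'v"
    and \<phi> :: "((weight \<Rightarrow> 'v \<Rightarrow> complex) \<times> (weight \<Rightarrow> 'v)) list"
  assumes "one_dim_rep chi"
    and "lam \<in> level_spherical (int K) chi"
    and "integrable_irreducible_hw_module smul act lam"
    and "set \<phi> \<subseteq> dual_completion_spherical smul act chi \<times> completion_spherical smul act chi"
  shows "\<exists>T\<ge>0. converges_on (Psi \<phi>) {(z, u, \<tau>) \<in> D_region. Im \<tau> > T}"
proof -
  interpret integrable_irreducible_hw_module smul act lam by fact
  obtain l0 l1 :: nat where lam: "lam $ 1 = of_nat l0" "lam $ 2 = of_nat l1" "lam $ 3 = 0"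
    using assms(2) unfolding level_spherical_def level_dominant_def weight_eval_basis
    by (auto elim!: Nats_cases)
  obtain C R :: real where "C \<ge> 0" "R \<ge> 1"
    "\<And>m n :: nat. cmod (Psi \<phi> (weight_below lam (int m) (int n))) \<le> C * R ^ (m + n)"
    using Psi_bound[OF lam(1,2) assms(1,4)] by blast
  then show ?thesis
    using Psi_support[OF lam(1,2) assms(4)]
    by (intro converges_on_of_exponential_bound[OF lam]) auto
qed

end
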